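(* Fix integers $m\geq 1$ and $d\geq 2$. Let $(\mathcal{A},\varphi)$ be a non-commutative probability space and let $Y\in\mathcal{A}$ be a (self-adjoint) random variable with $\varphi(Y)=0$, $\varphi(Y^2)=1$ and $\kappa_4(Y)=\varphi(Y^4)-2\geq 0$. Let $\mathbf{Y}=\{Y_i\}_{i\geq 1}$ be a sequence of freely independent copies of $Y$ in $(\mathcal{A},\varphi)$. For every $j=1,\dots,m$ and every $n\geq1$, let $f_n^{(j)}:[n]^d\to\mathbb{R}$ be a symmetric kernel vanishing on diagonals, and let $Q_{\mathbf{Y}}(f_n^{(j)})$ be the associated homogeneous sum of degree $d$. Assume that $$\lim_{n\to\infty}\varphi\big(Q_{\mathbf{Y}}(f_n^{(j)})\,Q_{\mathbf{Y}}(f_n^{(i)})\big)=C_{i,j}\qquad\text{for all } i,j=1,\dots,m,$$ where $C=(C_{i,j})_{i,j=1,\dots,m}$ is a real-valued, positive definite, symmetric matrix, and let $(s_1,\dots,s_m)$ be a semicircular system with covariance determined by $C$. Then the following statements are equivalent as $n\to\infty$: (i) $Q_{\mathbf{Y}}(f_n^{(j)})$ converges in law to $s_j$ for every $j=1,\dots,m$; (ii) $(Q_{\mathbf{Y}}(f_n^{(1)}),\dots,Q_{\mathbf{Y}}(f_n^{(m)}))$ converges in law to $(s_1,\dots,s_m)$.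
   Context: A non-commutative probability space $(\mathcal{A},\varphi)$ consists of a unital $*$-algebra $\mathcal{A}$ and a unital, faithful and positive trace $\varphi$ on $\mathcal{A}$; random variables are self-adjoint elements of $\mathcal{A}$. Copies of $Y$ are random variables $Y_i$ with the same moments as $Y$, i.e. $\varphi(Y_i^k)=\varphi(Y^k)$ for all $k\ge 1$; free independence is in the sense of Voiculescu. Convergence in law of (vectors of) non-commutative random variables means convergence of all (joint) moments: $(a_n^{(1)},\dots,a_n^{(m)})\to(s_1,\dots,s_m)$ in law if for every $k\ge1$ and all $j_1,\dots,j_k\in\{1,\dots,m\}$ the moment of $a_n^{(j_1)}\cdots a_n^{(j_k)}$ converges to the moment of $s_{j_1}\cdots s_{j_k}$. A semicircular system $(s_1,\dots,s_m)$ with covariance $C$ is a family of self-adjoint non-commutative random variables whose joint moments satisfy $\varphi(s_{j_1}\cdots s_{j_k})=\sum_{\pi}\prod_{\{a,b\}\in\pi}C_{j_a,j_b}$ for all $k\ge1$ and all $j_1,\dots,j_k$, where $\pi$ ranges over all non-crossing pairings of $\{1,\dots,k\}$ (an empty sum is $0$); in particular each $s_j$ has the centered semicircular law with variance $C_{j,j}$. Write $[n]=\{1,\dots,n\}$. For $f:[n]^d\to\mathbb{R}$, $$Q_{\mathbf{Y}}(f)=\sum_{i_1,\dots,i_d=1}^n f(i_1,\dots,i_d)\,Y_{i_1}\cdots Y_{i_d}.$$ The kernel $f$ vanishes on diagonals if $f(i_1,\dots,i_d)=0$ whenever $i_j=i_k$ for some $j\neq k$; it is symmetric if $f(i_1,\dots,i_d)=f(i_{\sigma(1)},\dots,i_{\sigma(d)})$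 for every permutation $\sigma$ of $\{1,\dots,d\}$ and every $(i_1,\dots,i_d)\in[n]^d$. *)

theory Defs
  imports "HOL-Analysis.Analysis" "HOL-Combinatorics.Permutations"
begin

section \<open>Non-commutative probability spaces\<close>

text \<open>
  The underlying type is the whole algebra. Complex scalar multiplication, the involution and
  the trace are explicit parameters, as there is no type class of complex \<open>*\<close>-algebras.
\<close>

locale star_algebra = vector_space smul
  for smul :: "complex \<Rightarrow> 'a::ring_1 \<Rightarrow> 'a" +
  fixes star :: "'a \<Rightarrow> 'a"
  assumes smul_mult_left: "smul c x * y = smul c (x * y)"
    and smul_mult_right: "x * smul c y = smul c (x * y)"
    and star_add: "star (x + y) = star x + star y"
    and star_smul: "star (smul c x) = smul (cnj c) (star x)"
    and star_mult: "star (x * y) = star y * star x"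
    and star_star: "star (star x) = x"

locale nc_prob_space = star_algebra smul star
  for smul :: "complex \<Rightarrow> 'a::ring_1 \<Rightarrow> 'a" and star :: "'a \<Rightarrow> 'a" +
  fixes phi :: "'a \<Rightarrow> complex"
  assumes phi_linear: "Vector_Spaces.linear smul (*) phi"
    and phi_unital: "phi 1 = 1"
    and phi_positive: "phi (star x * x) \<in> \<real>\<^sub>\<ge>\<^sub>0"
    and phi_faithful: "phi (star x * x) = 0 \<Longrightarrow> x = 0"
    and phi_trace: "phi (x * y) = phi (y * x)"

definition self_adjoint :: "('a \<Rightarrow> 'a) \<Rightarrow> 'a \<Rightarrow> bool" where
  "self_adjoint star x \<longleftrightarrow> star x = x"

definition copy_of :: "('a::ring_1 \<Rightarrow> 'a) \<Rightarrow> ('a \<Rightarrow> complex) \<Rightarrow> 'a \<Rightarrow> 'a \<Rightarrow> bool" where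
  "copy_of star phi y x \<longleftrightarrow> self_adjoint star x \<and> (\<forall>k\<ge>1. phi (x ^ k) = phi (y ^ k))"


section \<open>Free independence\<close>

definition unital_star_subalgebra ::
    "(complex \<Rightarrow> 'a::ring_1 \<Rightarrow> 'a) \<Rightarrow> ('a \<Rightarrow> 'a) \<Rightarrow> 'a set \<Rightarrow> bool" where
  "unital_star_subalgebra smul star B \<longleftrightarrow>
     module.subspace smul B \<and> 1 \<in> B \<and> (\<forall>x\<in>B. \<forall>y\<in>B. x * y \<in> B) \<and> (\<forall>x\<in>B. star x \<in> B)"

text \<open>
  Freeness of subalgebras: a product of centered elements, with neighbouring factors taken from
  subalgebras of different index, is centered.
\<close>

definition free_subalgebras :: "('a::ring_1 \<Rightarrow> complex) \<Rightarrow> 'i set \<Rightarrow> ('i \<Rightarrow> 'a set) \<Rightarrow> bool" where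
  "free_subalgebras phi I B \<longleftrightarrow>
     (\<forall>ix xs. xs \<noteq> [] \<longrightarrow> length ix = length xs \<longrightarrow>
        (\<forall>j<length xs. ix ! j \<in> I \<and> xs ! j \<in> B (ix ! j) \<and> phi (xs ! j) = 0) \<longrightarrow>
        (\<forall>j. Suc j < length xs \<longrightarrow> ix ! j \<noteq> ix ! Suc j) \<longrightarrow>
        phi (prod_list xs) = 0)"

definition freely_independent ::
    "(complex \<Rightarrow> 'a::ring_1 \<Rightarrow> 'a) \<Rightarrow> ('a \<Rightarrow> 'a) \<Rightarrow> ('a \<Rightarrow> complex) \<Rightarrow>
     'i set \<Rightarrow> ('i \<Rightarrow> 'a) \<Rightarrow> bool" where
  "freely_independent smul star phi I Y \<longleftrightarrow>
     free_subalgebras phi I (\<lambda>i. unital_star_subalgebra smul star hull {Y i})"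


section \<open>Homogeneous sums\<close>

text \<open>
  \<open>multi_indices n d\<close> is $[n]^d$, a multi-index being a list of length \<open>d\<close>. Kernels are functions on
  all lists; only their values on \<open>multi_indices n d\<close> are ever used.
\<close>

definition multi_indices :: "nat \<Rightarrow> nat \<Rightarrow> nat list set" where
  "multi_indices n d = {ix. length ix = d \<and> set ix \<subseteq> {1..n}}"

definition homogeneous_sum ::
    "(complex \<Rightarrow> 'a::ring_1 \<Rightarrow> 'a) \<Rightarrow> (nat \<Rightarrow> 'a) \<Rightarrow> nat \<Rightarrow> nat \<Rightarrow> (nat list \<Rightarrow> real) \<Rightarrow> 'a" where
  "homogeneous_sum smul Y n d f =
     (\<Sum>ix\<in>multi_indices n d. smul (complex_of_real (f ix)) (prod_list (map Y ix)))"

definition vanishes_on_diagonals :: "nat \<Rightarrow> nat \<Rightarrow> (nat list \<Rightarrow> real) \<Rightarrow> bool" where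
  "vanishes_on_diagonals n d f \<longleftrightarrow>
     (\<forall>ix\<in>multi_indices n d. (\<exists>j<d. \<exists>k<d. j \<noteq> k \<and> ix ! j = ix ! k) \<longrightarrow> f ix = 0)"

definition symmetric_kernel :: "nat \<Rightarrow> nat \<Rightarrow> (nat list \<Rightarrow> real) \<Rightarrow> bool" where
  "symmetric_kernel n d f \<longleftrightarrow>
     (\<forall>ix\<in>multi_indices n d. \<forall>\<sigma>. \<sigma> permutes {..<d} \<longrightarrow> f (permute_list \<sigma> ix) = f ix)"


section \<open>Semicircular systems\<close>

definition noncrossing_pairings :: "'i::linorder set \<Rightarrow> 'i set set set" where
  "noncrossing_pairings A =
     {p. partition_on A p \<and> (\<forall>V\<in>p. card V = 2) \<and>
         \<not> (\<exists>a b c e. a < b \<and> b < c \<and> c < e \<and> {a, c} \<in> p \<and> {b, e} \<in> p)}"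

definition symmetric_positive_definite :: "real ^ 'm ^ 'm \<Rightarrow> bool" where
  "symmetric_positive_definite C \<longleftrightarrow>
     (\<forall>i j. C $ i $ j = C $ j $ i) \<and> (\<forall>x. x \<noteq> 0 \<longrightarrow> x \<bullet> (C *v x) > 0)"

text \<open>
  Words in the variables are non-empty lists \<open>js\<close>, so pairings are taken of the positions
  \<open>{..<length js}\<close>, counted from 0. A block $\{a,b\}$ contributes $C_{j_a,j_b}$ with
  \<open>a = Min V\<close> and \<open>b = Max V\<close>; the order is immaterial since \<open>C\<close> is symmetric.
\<close>

definition semicircular_system ::
    "('b::ring_1 \<Rightarrow> 'b) \<Rightarrow> ('b \<Rightarrow> complex) \<Rightarrow> real ^ 'm ^ 'm \<Rightarrow> ('m \<Rightarrow> 'b) \<Rightarrow> bool" where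
  "semicircular_system star phi C s \<longleftrightarrow>
     (\<forall>j. self_adjoint star (s j)) \<and>
     (\<forall>js. js \<noteq> [] \<longrightarrow>
        phi (prod_list (map s js)) =
          complex_of_real (\<Sum>p\<in>noncrossing_pairings {..<length js}.
             \<Prod>V\<in>p. C $ (js ! Min V) $ (js ! Max V)))"


section \<open>Convergence in law\<close>

text \<open>The sequence and its limit may live in different spaces, with traces \<open>phi\<close> and \<open>psi\<close>.\<close>

definition converges_in_law ::
    "('a::ring_1 \<Rightarrow> complex) \<Rightarrow> ('b::ring_1 \<Rightarrow> complex) \<Rightarrow> (nat \<Rightarrow> 'a) \<Rightarrow> 'b \<Rightarrow> bool" where
  "converges_in_law phi psi a s \<longleftrightarrow>
     (\<forall>k\<ge>1. (\<lambda>n. phi (a n ^ k)) \<longlonglongrightarrow> psi (s ^ k))"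

definition jointly_converges_in_law ::
    "('a::ring_1 \<Rightarrow> complex) \<Rightarrow> ('b::ring_1 \<Rightarrow> complex) \<Rightarrow>
     (nat \<Rightarrow> 'm \<Rightarrow> 'a) \<Rightarrow> ('m \<Rightarrow> 'b) \<Rightarrow> bool" where
  "jointly_converges_in_law phi psi a s \<longleftrightarrow>
     (\<forall>js. js \<noteq> [] \<longrightarrow>
        (\<lambda>n. phi (prod_list (map (a n) js))) \<longlonglongrightarrow> psi (prod_list (map s js)))"

end

theory Submission
  imports Defs
begin

text \<open>
  Expanding products of homogeneous sums into reduced words in the centered letters $Y_i$ and
  $Y_i^2 - 1$ gives orthogonal sums whose coefficients are contractions of the kernels. Since
  $\kappa_4(Y) \ge 0$, the fourth moment of $Q_Y(f)$ exceeds $2 \|f\|^4$ by at least the sum of the squared norms of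
  the nontrivial contractions of \<open>f\<close> with itself; hence these vanish in the limit under (i), and so do
  the influences of \<open>f\<close>, which sit on the diagonal of the contraction over \<open>d - 1\<close> variables. Consequently
  multiplication by $Q_Y(f_n^{(j)})$ acts on reduced tensor products of the kernels, up to an error
  that tends to 0 in $L^2$, like a sum of free creation and annihilation operators. The error stays
  negligible after further multiplications, because (i) bounds the moments of each coordinate, and
  repeated Cauchy--Schwarz reflections bound all mixed moments by these. In the limit this yields the
  vacuum moments of semicircular operators on the free Fock space, which satisfy the same recursion
  as the sums over non-crossing pairings.
\<close>

section \<open>Free Fock moments and non-crossing pairings\<close>

text \<open>The only norm at hand is the L2 norm of the trace. No operator norm is available, so a
  small error cannot simply be multiplied by further sums: Cauchy--Schwarz has to collect all other
  factors on one side, where they form a mixed moment of twice the length, about which the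
  convergence of single coordinates says nothing directly.

  The sign of the fourth cumulant enters through \<open>K = phi (Y ^ 4) - 1\<close>, the squared
  norm of $Y_i^2 - 1$: it is the condition \<open>K \<ge> 1\<close>, under which a word containing
  such a letter has norm at least that of a word in the $Y_i$ alone. Since the kernels vanish at
  equal neighbouring indices, equal letters of a product can meet only at the seam of its two
  factors. Hence each word contains at most one square, and upper bounds lose no more than one
  factor \<open>K\<close>.

  The third moment of $Y$ is arbitrary, so $Y_i$ and $Y_i^2 - 1$ need not be orthogonal; words have
  to be told apart by their indices.\<close>

text \<open>The vacuum coefficient on the free Fock space of the vector obtained from the basis vector \<open>st\<close>
  by applying the semicircular operators of the letters in \<open>js\<close>, the first letter acting first.\<close>

fun fock_moment :: "('m \<Rightarrow> 'm \<Rightarrow> real) \<Rightarrow> 'm list \<Rightarrow> 'm list \<Rightarrow> real" where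
  "fock_moment c [] st = (if st = [] then 1 else 0)"
| "fock_moment c (j # js) st =
     fock_moment c js (j # st) + (case st of [] \<Rightarrow> 0 | i # st' \<Rightarrow> c j i * fock_moment c js st')"

text \<open>A pair consisting of a position \<open>a\<close> and a gap \<open>b\<close> is indexed
  by the later position \<open>c = Suc a + b\<close>. Below, \<open>a\<close> removes the newest
  letter of a stack and \<open>c\<close> the letter underneath.\<close>

lemma sum_triangle_shift:
  fixes A :: "nat \<Rightarrow> real"
  shows "(\<Sum>a<n. A a * (\<Sum>b<n - Suc a. B a b * D (Suc a + b))) =
         (\<Sum>c<n. (\<Sum>a<c. A a * B a (c - Suc a)) * D c)"
proof -
  have inner: "(\<Sum>b<n - Suc a. B a b * D (Suc a + b)) = (\<Sum>c\<in>{c\<in>{..<n}. a < c}. B a (c - Suc a) * D c)"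
    if "a < n" for a
    by (rule sum.reindex_bij_witness[of _ "\<lambda>c. c - Suc a" "\<lambda>b. Suc a + b"]) (use that in auto)
  have "(\<Sum>a<n. A a * (\<Sum>b<n - Suc a. B a b * D (Suc a + b))) =
        (\<Sum>a<n. \<Sum>c\<in>{c\<in>{..<n}. a < c}. A a * (B a (c - Suc a) * D c))"
    by (intro sum.cong refl) (simp only: inner lessThan_iff sum_distrib_left)
  also have "\<dots> = (\<Sum>c<n. \<Sum>a | a \<in> {..<n} \<and> a < c. A a * (B a (c - Suc a) * D c))"
    by (rule sum.swap_restrict) auto
  also have "\<dots> = (\<Sum>c<n. (\<Sum>a<c. A a * B a (c - Suc a)) * D c)"
  proof (intro sum.cong refl)
    fix c assume "c \<in> {..<n}"
    then have "{a. a \<in> {..<n} \<and> a < c} = {..<c}" by auto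
    then show "(\<Sum>a | a \<in> {..<n} \<and> a < c. A a * (B a (c - Suc a) * D c)) =
          (\<Sum>a<c. A a * B a (c - Suc a)) * D c"
      by (simp add: sum_distrib_right mult.assoc)
  qed
  finally show ?thesis .
qed

text \<open>The letter on top of the stack is removed by some letter \<open>js ! a\<close>, and the letters read before
  that form an excursion that starts and ends with the empty stack.\<close>

lemma fock_moment_stack:
  "fock_moment c js (i # st) =
     (\<Sum>a<length js. fock_moment c (take a js) [] * c (js ! a) i * fock_moment c (drop (Suc a) js) st)"
proof (induction "length js" arbitrary: js i st rule: less_induct)
  case less
  show ?case
  proof (cases js)
    case Nil
    then show ?thesis by simp
  next
    case (Cons j ks)
    let ?n = "length ks"
    let ?F = "\<lambda>ks. fock_moment c ks []"
    \<comment> \<open>Once \<open>j\<close> lies on top of \<open>i\<close>, some position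
      \<open>a\<close> removes \<open>j\<close> and a position after \<open>a\<close> removes
      \<open>i\<close>; the induction hypothesis is applied to each of the two removals.\<close>
    have "fock_moment c ks (j # i # st) =
        (\<Sum>a<?n. ?F (take a ks) * c (ks ! a) j * fock_moment c (drop (Suc a) ks) (i # st))"
      using less Cons by simp
    also have "\<dots> = (\<Sum>a<?n. (?F (take a ks) * c (ks ! a) j) *
        (\<Sum>b<?n - Suc a. ?F (take b (drop (Suc a) ks)) *
           (c (ks ! (Suc a + b)) i * fock_moment c (drop (Suc (Suc a + b)) ks) st)))"
    proof (intro sum.cong refl)
      fix a assume a: "a \<in> {..<?n}"
      have "fock_moment c (drop (Suc a) ks) (i # st) =
        (\<Sum>b<length (drop (Suc a) ks). ?F (take b (drop (Suc a) ks)) * c (drop (Suc a) ks ! b) i *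
           fock_moment c (drop (Suc b) (drop (Suc a) ks)) st)"
        using less Cons a by simp
      then show "?F (take a ks) * c (ks ! a) j * fock_moment c (drop (Suc a) ks) (i # st) =
         (?F (take a ks) * c (ks ! a) j) *
        (\<Sum>b<?n - Suc a. ?F (take b (drop (Suc a) ks)) *
           (c (ks ! (Suc a + b)) i * fock_moment c (drop (Suc (Suc a + b)) ks) st))"
        using a by (simp add: mult.assoc add_ac)
    qed
    also have "\<dots> = (\<Sum>e<?n. (\<Sum>a<e. (?F (take a ks) * c (ks ! a) j) * ?F (take (e - Suc a) (drop (Suc a) ks))) *
           (c (ks ! e) i * fock_moment c (drop (Suc e) ks) st))"
      by (rule sum_triangle_shift)
    also have "\<dots> = (\<Sum>e<?n. ?F (j # take e ks) * (c (ks ! e) i * fock_moment c (drop (Suc e) ks) st))"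
    proof (intro sum.cong refl arg_cong2[of _ _ _ _ "(*)"])
      fix e assume e: "e \<in> {..<?n}"
      \<comment> \<open>Read backwards, the induction hypothesis resums the removals of
        \<open>j\<close>: together with \<open>j\<close>, the letters before position
        \<open>e\<close> form a single excursion.\<close>
      have "?F (j # take e ks) = fock_moment c (take e ks) [j]" by simp
      also have "\<dots> = (\<Sum>a<length (take e ks). ?F (take a (take e ks)) * c (take e ks ! a) j *
           ?F (drop (Suc a) (take e ks)))"
        using less Cons e by simp
      also have "\<dots> = (\<Sum>a<e. (?F (take a ks) * c (ks ! a) j) * ?F (take (e - Suc a) (drop (Suc a) ks)))"
        using e by (intro sum.cong) (auto simp: drop_take min_def)
      finally show "(\<Sum>a<e. (?F (take a ks) * c (ks ! a) j) * ?F (take (e - Suc a) (drop (Suc a) ks))) =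
        ?F (j # take e ks)" ..
    qed
    finally have *: "fock_moment c ks (j # i # st) =
       (\<Sum>e<?n. ?F (j # take e ks) * (c (ks ! e) i * fock_moment c (drop (Suc e) ks) st))" .
    \<comment> \<open>The summand at 0 is the removal of \<open>i\<close> by \<open>j\<close>
      itself; \<open>*\<close> gives the other ones.\<close>
    show ?thesis
      unfolding Cons length_Cons sum.lessThan_Suc_shift
      using * by (simp add: mult.assoc)
  qed
qed

section \<open>Non-crossing pairings, decomposed by the partner of the last point\<close>

lemma noncrossing_pairings_empty: "noncrossing_pairings {} = {{}}"
  by (auto simp: noncrossing_pairings_def partition_on_def)

lemma finite_noncrossing_pairings: "finite A \<Longrightarrow> finite (noncrossing_pairings A)"
  by (rule finite_subset[of _ "Pow (Pow A)"]) (auto simp: noncrossing_pairings_def partition_on_def)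

lemma noncrossing_pairings_pairE:
  assumes "p \<in> noncrossing_pairings A" "V \<in> p"
  obtains x y where "V = {x, y}" "x < y" "x \<in> A" "y \<in> A"
proof -
  have "card V = 2" "V \<subseteq> A"
    using assms by (auto simp: noncrossing_pairings_def partition_on_def)
  then obtain x y where xy: "V = {x, y}" "x \<noteq> y" by (auto simp: card_2_iff)
  then consider "x < y" | "y < x" by fastforce
  then show ?thesis
  proof cases
    case 1
    show ?thesis by (rule that[OF xy(1) 1]) (use xy \<open>V \<subseteq> A\<close> in auto)
  next
    case 2
    show ?thesis by (rule that[OF _ 2]) (use xy \<open>V \<subseteq> A\<close> in auto)
  qed
qed

definition close_pairing :: "nat \<Rightarrow> nat \<times> nat set set \<times> nat set set \<Rightarrow> nat set set" where
  "close_pairing b = (\<lambda>(c, p, q). insert {c, b} (p \<union> q))"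

text \<open>If \<open>c\<close> is the partner of the last point \<open>b\<close>, a pair with one
  point on each side of \<open>c\<close> would cross \<open>{c, b}\<close>. So the remaining pairs
  form independent non-crossing pairings to the left of \<open>c\<close> and between
  \<open>c\<close> and \<open>b\<close>.\<close>

lemma noncrossing_pairings_Suc:
  fixes a b :: nat
  assumes "a \<le> b"
  shows "bij_betw (close_pairing b)
     (SIGMA c:{a..<b}. noncrossing_pairings {a..<c} \<times> noncrossing_pairings {Suc c..<b})
     (noncrossing_pairings {a..<Suc b})"
  unfolding bij_betw_def
proof (intro conjI equalityI subsetI)
  let ?S = "SIGMA c:{a..<b}. noncrossing_pairings {a..<c} \<times> noncrossing_pairings {Suc c..<b}"
  have sub: "V \<subseteq> A" if "p \<in> noncrossing_pairings A" "V \<in> p" for p V and A :: "nat set"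
    using that by (auto simp: noncrossing_pairings_def partition_on_def)
  have ne: "V \<noteq> {}" if "p \<in> noncrossing_pairings A" "V \<in> p" for p V and A :: "nat set"
    using that by (auto simp: noncrossing_pairings_def)
  show "inj_on (close_pairing b) ?S"
  proof (rule inj_onI)
    fix u v assume u: "u \<in> ?S" and v: "v \<in> ?S" and eq: "close_pairing b u = close_pairing b v"
    obtain c p q where uu: "u = (c, p, q)" by (cases u)
    obtain c' p' q' where vv: "v = (c', p', q')" by (cases v)
    \<comment> \<open>Injectivity: the closed pairing determines \<open>c\<close> as the partner of
      \<open>b\<close>, and then \<open>p\<close> and \<open>q\<close> by the location of their
      blocks.\<close>
    have rec: "c = (THE c'. {c', b} \<in> close_pairing b (c, p, q)) \<and>
          p = {V \<in> close_pairing b (c, p, q). V \<subseteq> {a..<c}} \<and>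
          q = {V \<in> close_pairing b (c, p, q). V \<subseteq> {Suc c..<b}}"
      if "(c, p, q) \<in> ?S" for c p q
    proof (intro conjI)
      have c: "a \<le> c" "c < b" and p: "p \<in> noncrossing_pairings {a..<c}"
        and q: "q \<in> noncrossing_pairings {Suc c..<b}" using that by auto
      have disj: "V \<notin> p \<or> V \<notin> q" for V
        using sub[OF p, of V] sub[OF q, of V] ne[OF p, of V] by fastforce
      have xb: "{x, b} \<notin> p" "{x, b} \<notin> q" for x
        using sub[OF p, of "{x, b}"] sub[OF q, of "{x, b}"] c by auto
      show "c = (THE c'. {c', b} \<in> close_pairing b (c, p, q))"
        by (rule the_equality[symmetric]) (use xb in \<open>auto simp: close_pairing_def doubleton_eq_iff\<close>)
      show "p = {V \<in> close_pairing b (c, p, q). V \<subseteq> {a..<c}}"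
      proof -
        have "\<not> V \<subseteq> {a..<c}" if "V \<in> q" for V
          using sub[OF q that] ne[OF q that] by fastforce
        moreover have "V \<subseteq> {a..<c}" if "V \<in> p" for V using sub[OF p that] .
        ultimately show ?thesis by (auto simp: close_pairing_def)
      qed
      show "q = {V \<in> close_pairing b (c, p, q). V \<subseteq> {Suc c..<b}}"
      proof -
        have "\<not> V \<subseteq> {Suc c..<b}" if "V \<in> p" for V
          using sub[OF p that] ne[OF p that] by fastforce
        moreover have "V \<subseteq> {Suc c..<b}" if "V \<in> q" for V using sub[OF q that] .
        ultimately show ?thesis by (auto simp: close_pairing_def)
      qed
    qed
    let ?P = "close_pairing b (c, p, q)"
    have P: "close_pairing b (c', p', q') = ?P" using eq uu vv by simp
    have 1: "c = (THE c'. {c', b} \<in> ?P) \<and> p = {V \<in> ?P. V \<subseteq> {a..<c}} \<and> q = {V \<in> ?P. V \<subseteq> {Suc c..<b}}"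
      by (rule rec) (use u uu in simp)
    have 2: "c' = (THE c'. {c', b} \<in> ?P) \<and> p' = {V \<in> ?P. V \<subseteq> {a..<c'}} \<and> q' = {V \<in> ?P. V \<subseteq> {Suc c'..<b}}"
      unfolding P[symmetric] by (rule rec) (use v vv in simp)
    have "c = c'" using conjunct1[OF 1] conjunct1[OF 2] by (rule trans[OF _ sym])
    define P where "P = ?P"
    have "p = p'" "q = q'"
      using conjunct2[OF 1] conjunct2[OF 2] unfolding P_def[symmetric] \<open>c = c'\<close> by argo+
    then show "u = v" using \<open>c = c'\<close> uu vv by simp
  qed
  show "x \<in> noncrossing_pairings {a..<Suc b}" if x: "x \<in> close_pairing b ` ?S" for x
  proof -
    obtain c p q where c: "a \<le> c" "c < b" and p: "p \<in> noncrossing_pairings {a..<c}"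
      and q: "q \<in> noncrossing_pairings {Suc c..<b}" and xx: "x = insert {c, b} (p \<union> q)"
      using x by (auto simp: close_pairing_def)
    have un: "\<Union>p = {a..<c}" "\<Union>q = {Suc c..<b}"
      using p q by (auto simp: noncrossing_pairings_def partition_on_def)
    have "\<Union>x = {c, b} \<union> ({a..<c} \<union> {Suc c..<b})" using xx un by auto
    also have "\<dots> = {a..<Suc b}" using c by auto
    finally have U: "\<Union>x = {a..<Suc b}" .
    have D: "disjoint x"
    proof (rule disjointI)
      fix V W assume VW: "V \<in> x" "W \<in> x" "V \<noteq> W"
      have kind: "V = {c, b} \<or> (V \<in> p \<and> V \<subseteq> {a..<c}) \<or> (V \<in> q \<and> V \<subseteq> {Suc c..<b})"
        if "V \<in> x" for V
        using that sub[OF p, of V] sub[OF q, of V] xx by blast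
      have "disjoint p" "disjoint q" using p q by (auto simp: noncrossing_pairings_def partition_on_def)
      then have pq: "V \<inter> W = {}" if "V \<in> p \<and> W \<in> p \<or> V \<in> q \<and> W \<in> q"
        using that VW(3) by (auto dest: disjointD)
      have "{c, b} \<inter> {a..<c} = {}" "{c, b} \<inter> {Suc c..<b} = {}" "{a..<c} \<inter> {Suc c..<b} = {}"
        using c by auto
      then show "V \<inter> W = {}"
        using kind[OF VW(1)] kind[OF VW(2)] pq VW(3) by blast
    qed
    have part: "partition_on {a..<Suc b} x"
      using U D ne[OF p] ne[OF q] xx by (auto simp: partition_on_def)
    have card: "card V = 2" if "V \<in> x" for V
    proof -
      have "\<forall>V\<in>p. card V = 2" "\<forall>V\<in>q. card V = 2" using p q by (simp_all add: noncrossing_pairings_def)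
      moreover have "card {c, b} = 2" using c by simp
      ultimately show ?thesis using that xx by blast
    qed
    have cases: "(y = c \<and> z = b) \<or> ({y, z} \<in> p \<and> y < c \<and> z < c) \<or> ({y, z} \<in> q \<and> c < y \<and> c < z \<and> z < b)"
      if "{y, z} \<in> x" "y < z" for y z
      using that sub[OF p, of "{y,z}"] sub[OF q, of "{y,z}"] c unfolding xx
      by (auto simp: doubleton_eq_iff)
    have "\<not> (\<exists>y z u v. y < z \<and> z < u \<and> u < v \<and> {y, u} \<in> x \<and> {z, v} \<in> x)"
    proof
      assume "\<exists>y z u v. y < z \<and> z < u \<and> u < v \<and> {y, u} \<in> x \<and> {z, v} \<in> x"
      then obtain y z u v where 1: "y < z" "z < u" "u < v" "{y, u} \<in> x" "{z, v} \<in> x" by blast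
      have "\<not> (\<exists>a b c e. a < b \<and> b < c \<and> c < e \<and> {a, c} \<in> p \<and> {b, e} \<in> p)"
           "\<not> (\<exists>a b c e. a < b \<and> b < c \<and> c < e \<and> {a, c} \<in> q \<and> {b, e} \<in> q)"
        using p q by (simp_all add: noncrossing_pairings_def)
      then have "\<not> ({y, u} \<in> p \<and> {z, v} \<in> p)" "\<not> ({y, u} \<in> q \<and> {z, v} \<in> q)"
        using 1 by metis+
      moreover have "y < u" "z < v" using 1 by auto
      ultimately show False using cases[of y u] cases[of z v] 1 by linarith
    qed
    then show ?thesis using part card unfolding noncrossing_pairings_def by blast
  qed
  show "x \<in> close_pairing b ` ?S" if x: "x \<in> noncrossing_pairings {a..<Suc b}" for x
  proof -
    have part: "partition_on {a..<Suc b} x" and card: "\<And>V. V \<in> x \<Longrightarrow> card V = 2"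
      and ncr: "\<not> (\<exists>y z u v. y < z \<and> z < u \<and> u < v \<and> {y, u} \<in> x \<and> {z, v} \<in> x)"
      using x by (simp_all add: noncrossing_pairings_def)
    have U: "\<Union>x = {a..<Suc b}" and D: "disjoint x" and N: "{} \<notin> x"
      using part by (auto simp: partition_on_def)
    obtain B where B: "B \<in> x" "b \<in> B" using U assms by (metis UnionE atLeastLessThan_iff lessI)
    obtain y z where yz: "B = {y, z}" "y < z" "y \<in> {a..<Suc b}" "z \<in> {a..<Suc b}"
      using noncrossing_pairings_pairE[OF x B(1)] by metis
    define c where "c = y"
    have zb: "z = b" using yz B(2) by auto
    have c: "a \<le> c" "c < b" "{c, b} \<in> x" using yz zb B c_def by auto
    define p where "p = {V \<in> x. V \<subseteq> {a..<c}}"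
    define q where "q = {V \<in> x. V \<subseteq> {Suc c..<b}}"
    have split: "V = {c, b} \<or> V \<in> p \<or> V \<in> q" if V: "V \<in> x" for V
    proof (cases "V = {c, b}")
      case False
      obtain u v where uv: "V = {u, v}" "u < v" "u \<in> {a..<Suc b}" "v \<in> {a..<Suc b}"
        using noncrossing_pairings_pairE[OF x V] by metis
      have "V \<inter> {c, b} = {}" using D V c False by (metis disjointD)
      then have "u \<noteq> c" "v \<noteq> c" "u \<noteq> b" "v \<noteq> b" using uv by auto
      \<comment> \<open>Here \<open>v < b\<close>, so a pair around \<open>c\<close> would cross
        \<open>{c, b}\<close>.\<close>
      moreover have "\<not> (u < c \<and> c < v)" 
        using ncr uv V c calculation by (metis atLeastLessThan_iff less_antisym)
      ultimately show ?thesis using uv V by (auto simp: p_def q_def)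
    qed simp
    have eq: "x = close_pairing b (c, p, q)"
      using split c by (auto simp: close_pairing_def p_def q_def)
    have cov: "\<exists>V\<in>x. y \<in> V \<and> V \<noteq> {c, b}" if "y \<in> {a..<Suc b}" "y \<noteq> c" "y \<noteq> b" for y
      using U that by (metis UnionE insertE singletonD)
    have Up: "\<Union>p = {a..<c}"
    proof
      show "{a..<c} \<subseteq> \<Union>p"
      proof
        fix y assume y: "y \<in> {a..<c}"
        obtain V where V: "V \<in> x" "y \<in> V" "V \<noteq> {c, b}" using cov[of y] y c by auto
        have "V \<notin> q" using V y by (auto simp: q_def)
        then show "y \<in> \<Union>p" using split[OF V(1)] V by auto
      qed
    qed (auto simp: p_def)
    have Uq: "\<Union>q = {Suc c..<b}"
    proof
      show "{Suc c..<b} \<subseteq> \<Union>q"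
      proof
        fix y assume y: "y \<in> {Suc c..<b}"
        obtain V where V: "V \<in> x" "y \<in> V" "V \<noteq> {c, b}" using cov[of y] y c by auto
        have "V \<notin> p" using V y by (auto simp: p_def)
        then show "y \<in> \<Union>q" using split[OF V(1)] V by auto
      qed
    qed (auto simp: q_def)
    have px: "p \<subseteq> x" "q \<subseteq> x" by (auto simp: p_def q_def)
    then have dj: "disjoint p" "disjoint q" using D unfolding disjoint_def by blast+
    have sub: "r \<in> noncrossing_pairings S" if "\<Union>r = S" "disjoint r" "r \<subseteq> x" for r S
    proof -
      have "{} \<notin> r" using that(3) N by blast
      then have "partition_on S r" using that(1,2) by (simp add: partition_on_def)
      moreover have "\<forall>V\<in>r. card V = 2" using that card by blast
      moreover have "\<not> (\<exists>y z u v. y < z \<and> z < u \<and> u < v \<and> {y, u} \<in> r \<and> {z, v} \<in> r)"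
      proof (rule notI, elim exE conjE)
        fix y z u v assume "y < z" "z < u" "u < v" "{y, u} \<in> r" "{z, v} \<in> r"
        then show False using ncr subsetD[OF that(3)] by metis
      qed
      ultimately show ?thesis by (simp add: noncrossing_pairings_def)
    qed
    have "p \<in> noncrossing_pairings {a..<c}" "q \<in> noncrossing_pairings {Suc c..<b}"
      by (rule sub[OF Up dj(1) px(1)], rule sub[OF Uq dj(2) px(2)])
    then show ?thesis using eq c by auto
  qed
qed

definition nc_pairing_sum :: "(nat \<Rightarrow> nat \<Rightarrow> real) \<Rightarrow> nat set \<Rightarrow> real" where
  "nc_pairing_sum w A = (\<Sum>p\<in>noncrossing_pairings A. \<Prod>V\<in>p. w (Min V) (Max V))"

lemma nc_pairing_sum_empty [simp]: "nc_pairing_sum w {} = 1"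
  by (simp add: nc_pairing_sum_def noncrossing_pairings_empty)

text \<open>The weighted recursion of the Catalan numbers, in the shape of
  \<open>fock_moment_stack\<close> for a stack with one letter.\<close>

lemma nc_pairing_sum_Suc:
  fixes a b :: nat
  assumes "a \<le> b"
  shows "nc_pairing_sum w {a..<Suc b} =
     (\<Sum>c\<in>{a..<b}. nc_pairing_sum w {a..<c} * w c b * nc_pairing_sum w {Suc c..<b})"
proof -
  let ?W = "\<lambda>p. \<Prod>V\<in>p. w (Min V) (Max V)"
  let ?A = "\<lambda>c. noncrossing_pairings {a..<c}" and ?B = "\<lambda>c. noncrossing_pairings {Suc c..<b}"
  have W: "?W (close_pairing b (c, p, q)) = ?W p * w c b * ?W q"
    if c: "c \<in> {a..<b}" and p: "p \<in> ?A c" and q: "q \<in> ?B c" for c p q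
  proof -
    have ps: "p \<subseteq> Pow {a..<c}" and qs: "q \<subseteq> Pow {Suc c..<b}" and pn: "{} \<notin> p"
      using p q by (auto simp: noncrossing_pairings_def partition_on_def)
    have fin: "finite p" "finite q"
      using finite_subset[OF ps] finite_subset[OF qs] by simp_all
    have disj: "p \<inter> q = {}"
    proof (rule ccontr)
      assume "p \<inter> q \<noteq> {}"
      then obtain V where V: "V \<in> p" "V \<in> q" by auto
      then have "V \<subseteq> {a..<c} \<inter> {Suc c..<b}" using ps qs by blast
      also have "\<dots> = {}" by auto
      finally show False using V(1) pn by simp
    qed
    have "{c, b} \<notin> p" using ps by fastforce
    moreover have "{c, b} \<notin> q" using qs by fastforce
    ultimately have notin: "{c, b} \<notin> p \<union> q" by simp
    have mm: "Min {c, b} = c" "Max {c, b} = b" using c by simp_all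
    have "?W (close_pairing b (c, p, q)) = w (Min {c, b}) (Max {c, b}) * ?W (p \<union> q)"
      unfolding close_pairing_def prod.case
      by (rule prod.insert[OF finite_UnI[OF fin] notin])
    also have "?W (p \<union> q) = ?W p * ?W q" by (rule prod.union_disjoint[OF fin disj])
    finally show ?thesis unfolding mm by (simp only: ac_simps)
  qed
  have "nc_pairing_sum w {a..<Suc b} = (\<Sum>x\<in>(SIGMA c:{a..<b}. ?A c \<times> ?B c). ?W (close_pairing b x))"
    unfolding nc_pairing_sum_def
    by (rule sum.reindex_bij_betw[OF noncrossing_pairings_Suc[OF assms], symmetric])
  also have "\<dots> = (\<Sum>c\<in>{a..<b}. \<Sum>x\<in>?A c \<times> ?B c. ?W (close_pairing b (c, x)))"
    by (subst sum.Sigma) (simp_all add: finite_noncrossing_pairings split_def)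
  also have "\<dots> = (\<Sum>c\<in>{a..<b}. nc_pairing_sum w {a..<c} * w c b * nc_pairing_sum w {Suc c..<b})"
  proof (intro sum.cong refl)
    fix c assume c: "c \<in> {a..<b}"
    have "(\<Sum>x\<in>?A c \<times> ?B c. ?W (close_pairing b (c, x))) =
        (\<Sum>p\<in>?A c. \<Sum>q\<in>?B c. ?W (close_pairing b (c, p, q)))"
      by (rule sum.cartesian_product')
    also have "\<dots> = (\<Sum>p\<in>?A c. \<Sum>q\<in>?B c. ?W p * w c b * ?W q)"
      by (intro sum.cong refl W[OF c])
    also have "\<dots> = nc_pairing_sum w {a..<c} * w c b * nc_pairing_sum w {Suc c..<b}"
      unfolding nc_pairing_sum_def sum_distrib_left sum_distrib_right by (rule sum.swap)
    finally show "(\<Sum>x\<in>?A c \<times> ?B c. ?W (close_pairing b (c, x))) = \<dots>" .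
  qed
  finally show ?thesis .
qed

text \<open>Both sides split at the partner of the last position, which leaves two shorter
  intervals; hence the induction over intervals instead of whole words. The word is reversed because
  its last letter acts first.\<close>

lemma fock_moment_eq_nc_pairing_sum:
  fixes js :: "'m list"
  assumes "a \<le> b" "b \<le> length js"
  shows "fock_moment c (rev (drop a (take b js))) [] = nc_pairing_sum (\<lambda>x y. c (js ! x) (js ! y)) {a..<b}"
  using assms
proof (induction "b - a" arbitrary: a b rule: less_induct)
  case less
  let ?s = "\<lambda>a b. rev (drop a (take b js))"
  show ?case
  proof (cases "a = b")
    case False
    then obtain e where b: "b = Suc e" "a \<le> e" using less.prems by (cases b) auto
    have e: "e < length js" using b less.prems by simp
    have sl: "?s a b = js ! e # ?s a e"
      using b e by (simp add: take_Suc_conv_app_nth)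
    have len: "length (?s a e) = e - a" using e by simp
    have "fock_moment c (?s a b) [] = fock_moment c (?s a e) [js ! e]" by (simp add: sl)
    also have "\<dots> = (\<Sum>k<e - a. fock_moment c (take k (?s a e)) [] * c (?s a e ! k) (js ! e) *
        fock_moment c (drop (Suc k) (?s a e)) [])"
      by (subst fock_moment_stack) (simp only: len)
    also have "\<dots> = (\<Sum>x\<in>{a..<e}. fock_moment c (?s a x) [] * c (js ! x) (js ! e) * fock_moment c (?s (Suc x) e) [])"
    proof (rule sum.reindex_bij_witness[of _ "\<lambda>x. e - Suc x" "\<lambda>k. e - Suc k"])
      fix k assume k: "k \<in> {..<e - a}"
      \<comment> \<open>Index \<open>k\<close> of the reversed segment is position
        \<open>e - Suc k\<close>, so the letters read before the removal are those to the right of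
        the partner.\<close>
      have 1: "take k (?s a e) = ?s (Suc (e - Suc k)) e"
        using k e by (simp add: take_rev Suc_diff_Suc)
      have 2: "?s a e ! k = js ! (e - Suc k)"
        using k e by (simp add: rev_nth)
      have 3: "drop (Suc k) (?s a e) = ?s a (e - Suc k)"
        using k e by (simp add: drop_rev take_drop min_def)
      show "fock_moment c (?s a (e - Suc k)) [] * c (js ! (e - Suc k)) (js ! e) * fock_moment c (?s (Suc (e - Suc k)) e) []
         = fock_moment c (take k (?s a e)) [] * c (?s a e ! k) (js ! e) * fock_moment c (drop (Suc k) (?s a e)) []"
        unfolding 1 2 3 by simp
    qed (auto)
    also have "\<dots> = (\<Sum>x\<in>{a..<e}. nc_pairing_sum (\<lambda>x y. c (js ! x) (js ! y)) {a..<x} * c (js ! x) (js ! e) *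
        nc_pairing_sum (\<lambda>x y. c (js ! x) (js ! y)) {Suc x..<e})"
    proof (intro sum.cong refl)
      fix x assume "x \<in> {a..<e}"
      then have x: "a \<le> x" "x < e" by auto
      have "fock_moment c (?s a x) [] = nc_pairing_sum (\<lambda>x y. c (js ! x) (js ! y)) {a..<x}"
        by (rule less.hyps) (use x e b in auto)
      moreover have "fock_moment c (?s (Suc x) e) [] = nc_pairing_sum (\<lambda>x y. c (js ! x) (js ! y)) {Suc x..<e}"
        by (rule less.hyps) (use x e b in auto)
      ultimately show "fock_moment c (?s a x) [] * c (js ! x) (js ! e) * fock_moment c (?s (Suc x) e) [] =
         nc_pairing_sum (\<lambda>x y. c (js ! x) (js ! y)) {a..<x} * c (js ! x) (js ! e) *
         nc_pairing_sum (\<lambda>x y. c (js ! x) (js ! y)) {Suc x..<e}" by simp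
    qed
    also have "\<dots> = nc_pairing_sum (\<lambda>x y. c (js ! x) (js ! y)) {a..<b}"
      unfolding b(1) by (rule nc_pairing_sum_Suc[OF b(2), symmetric])
    finally show ?thesis .
  qed simp
qed

section \<open>Reduced words in free variables\<close>

lemma distinct_adj_rev_append:
  "distinct_adj (rev xs @ ys) \<longleftrightarrow> distinct_adj xs \<and> distinct_adj ys \<and> (xs = [] \<or> ys = [] \<or> hd xs \<noteq> hd ys)"
  by (auto simp: distinct_adj_append_iff distinct_adj_rev last_rev)

context nc_prob_space
begin

section \<open>The trace as an inner product\<close>

lemma phi_add: "phi (x + y) = phi x + phi y"
  and phi_diff: "phi (x - y) = phi x - phi y"
  and phi_smul: "phi (smul c x) = c * phi x"
  and phi_zero [simp]: "phi 0 = 0"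
  and phi_sum: "phi (\<Sum>i\<in>I. g i) = (\<Sum>i\<in>I. phi (g i))"
proof -
  interpret phi: Vector_Spaces.linear smul "(*)" phi by (rule phi_linear)
  show "phi (x + y) = phi x + phi y" "phi (x - y) = phi x - phi y" "phi (smul c x) = c * phi x"
    "phi 0 = 0" "phi (\<Sum>i\<in>I. g i) = (\<Sum>i\<in>I. phi (g i))"
    by (fact phi.add phi.diff phi.scale phi.zero phi.sum)+
qed

lemma star_zero [simp]: "star 0 = 0"
  using star_add[of 0 0] by simp

lemma star_one [simp]: "star 1 = 1"
  using star_mult[of "star 1" 1] by (simp add: star_star)

lemma star_diff: "star (x - y) = star x - star y"
  using star_add[of "x - y" y] by (simp add: algebra_simps)

lemma star_sum: "star (\<Sum>i\<in>I. g i) = (\<Sum>i\<in>I. star (g i))"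
  by (induction I rule: infinite_finite_induct) (simp_all add: star_add)

lemma star_prod_list: "star (prod_list xs) = prod_list (rev (map star xs))"
  by (induction xs) (simp_all add: star_mult)

definition nsq :: "'a \<Rightarrow> real" where
  "nsq x = Re (phi (star x * x))"

lemma nsq_nonneg: "0 \<le> nsq x"
  and phi_star_self: "phi (star x * x) = complex_of_real (nsq x)"
  using phi_positive[of x] by (auto simp: nsq_def complex_nonneg_Reals_iff complex_eq_iff)

text \<open>By positivity \<open>phi (star z * z)\<close> is real for
  \<open>z = x + smul c 1\<close>. The choice \<open>c = 1\<close> compares the imaginary parts of
  the two traces, \<open>c = \<i>\<close> the real parts.\<close>

lemma phi_star: "phi (star x) = cnj (phi x)"
proof -
  have exp: "phi (star (x + smul c 1) * (x + smul c 1)) =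
      phi (star x * x) + c * phi (star x) + cnj c * phi x + cnj c * c" for c
    by (simp add: star_add star_smul distrib_left distrib_right smul_mult_left smul_mult_right
        phi_add phi_smul phi_unital)
  have im: "Im (c * phi (star x) + cnj c * phi x) = 0" for c
    using arg_cong[OF exp[of c], of Im] by (simp add: phi_star_self)
  show ?thesis using im[of 1] im[of \<i>] by (simp add: complex_eq_iff)
qed

lemma nsq_star: "nsq (star x) = Re (phi (x * star x))"
  by (simp add: nsq_def star_star)

lemma nsq_diff_smul:
  "nsq (y - smul t x) = nsq y - 2 * Re (cnj t * phi (star x * y)) + (cmod t)\<^sup>2 * nsq x"
proof -
  have c: "phi (star y * x) = cnj (phi (star x * y))"
    using phi_star[of "star x * y"] by (simp add: star_mult star_star)
  have "phi (star (y - smul t x) * (y - smul t x)) =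
      phi (star y * y) - t * cnj (phi (star x * y)) - cnj t * phi (star x * y) + cnj t * t * phi (star x * x)"
    by (simp add: star_diff star_smul right_diff_distrib left_diff_distrib smul_mult_left smul_mult_right
        phi_diff phi_smul c)
  also have "cnj t * t = complex_of_real ((cmod t)\<^sup>2)"
    using complex_norm_square[of t] by (metis mult.commute)
  finally have E: "phi (star (y - smul t x) * (y - smul t x)) =
      phi (star y * y) - t * cnj (phi (star x * y)) - cnj t * phi (star x * y) +
      complex_of_real ((cmod t)\<^sup>2) * phi (star x * x)" .
  show ?thesis
    using arg_cong[OF E, of Re] by (simp add: phi_star_self)
qed

lemma phi_cauchy_schwarz: "(cmod (phi (star x * y)))\<^sup>2 \<le> nsq x * nsq y"
proof (cases "nsq x = 0")
  case True
  then have "x = 0" using phi_faithful[of x] phi_star_self[of x] by simp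
  then show ?thesis by (simp add: nsq_def)
next
  case False
  define N where "N = nsq x"
  have N: "N > 0" using False nsq_nonneg[of x] by (simp add: N_def)
  define b where "b = phi (star x * y)"
  \<comment> \<open>The scalar \<open>b / N\<close> minimises \<open>nsq (y - smul t x)\<close> over
    \<open>t\<close>.\<close>
  have "0 \<le> nsq (y - smul (b / N) x)" by (rule nsq_nonneg)
  also have "\<dots> = nsq y - 2 * Re (cnj (b / N) * b) + (cmod (b / N))\<^sup>2 * N"
    by (simp add: nsq_diff_smul b_def N_def)
  also have "cnj (b / N) * b = complex_of_real ((cmod b)\<^sup>2) / N"
    unfolding complex_norm_square by (simp add: mult.commute)
  also have "(cmod (b / N))\<^sup>2 * N = (cmod b)\<^sup>2 / N"
    using N by (simp add: norm_divide power_divide power2_eq_square)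
  finally have "(cmod b)\<^sup>2 / N \<le> nsq y" by simp
  then have "(cmod b)\<^sup>2 \<le> nsq y * N" using N by (simp add: pos_divide_le_eq)
  then show ?thesis unfolding b_def N_def by (simp only: mult.commute)
qed

lemma nsq_orthogonal_sum:
  assumes "finite I" and orth: "\<And>i j. i \<in> I \<Longrightarrow> j \<in> I \<Longrightarrow> i \<noteq> j \<Longrightarrow> phi (star (e i) * e j) = 0"
  shows "nsq (\<Sum>i\<in>I. smul (complex_of_real (c i)) (e i)) = (\<Sum>i\<in>I. (c i)\<^sup>2 * nsq (e i))"
proof -
  have "phi (star (\<Sum>i\<in>I. smul (complex_of_real (c i)) (e i)) * (\<Sum>i\<in>I. smul (complex_of_real (c i)) (e i)))
      = (\<Sum>i\<in>I. \<Sum>j\<in>I. phi (star (smul (complex_of_real (c i)) (e i)) * smul (complex_of_real (c j)) (e j)))"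
    unfolding star_sum sum_product phi_sum by (rule refl)
  also have "\<dots> = (\<Sum>i\<in>I. \<Sum>j\<in>I. if i = j then complex_of_real ((c i)\<^sup>2 * nsq (e i)) else 0)"
  proof (intro sum.cong refl)
    fix i j assume ij: "i \<in> I" "j \<in> I"
    have "phi (star (smul (complex_of_real (c i)) (e i)) * smul (complex_of_real (c j)) (e j)) =
        complex_of_real (c i * c j) * phi (star (e i) * e j)"
      by (simp add: star_smul smul_mult_left smul_mult_right phi_smul)
    then show "phi (star (smul (complex_of_real (c i)) (e i)) * smul (complex_of_real (c j)) (e j)) =
        (if i = j then complex_of_real ((c i)\<^sup>2 * nsq (e i)) else 0)"
      using orth[OF ij] by (cases "i = j") (simp_all add: phi_star_self power2_eq_square)
  qed
  also have "\<dots> = complex_of_real (\<Sum>i\<in>I. (c i)\<^sup>2 * nsq (e i))"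
    using assms(1) by simp
  finally show ?thesis by (simp add: nsq_def)
qed

text \<open>Among the words of length \<open>2 * m\<close> take one whose moment has maximal modulus. By Cauchy--Schwarz,
  replacing its second half by the mirror image of the first half keeps the modulus maximal; after a
  suitable rotation this doubles an initial run of equal letters, until the word is a power.\<close>

lemma chessboard_estimate:
  fixes X :: "'m::finite \<Rightarrow> 'a"
  assumes sa: "\<And>j. star (X j) = X j" and m: "m \<ge> 1"
  shows "\<exists>j. \<forall>js. length js = 2 * m \<longrightarrow> cmod (phi (prod_list (map X js))) \<le> cmod (phi (X j ^ (2 * m)))"
proof -
  define P where "P js = prod_list (map X js)" for js
  have P_app: "P (us @ vs) = P us * P vs" for us vs by (simp add: P_def)
  have P_star: "star (P us) = P (rev us)" for us
    by (simp add: P_def star_prod_list rev_map sa comp_def)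
  define M where "M js = cmod (phi (P js))" for js
  have rot: "M (us @ vs) = M (vs @ us)" for us vs
    unfolding M_def P_app by (simp add: phi_trace)
  define W where "W = {js :: 'm list. length js = 2 * m}"
  have finW: "finite W"
    using finite_lists_length_eq[of "UNIV :: 'm set" "2 * m"] by (simp add: W_def)
  have "replicate (2 * m) undefined \<in> W" by (simp add: W_def)
  then have neW: "W \<noteq> {}" by blast
  define S where "S = Max (M ` W)"
  have S_ge: "M js \<le> S" if "js \<in> W" for js using that finW by (simp add: S_def)
  obtain w where w: "w \<in> W" "M w = S"
    using Max_in[OF finite_imageI[OF finW], of M] neW unfolding S_def by fastforce
  have S0: "S \<ge> 0" using w(2) by (auto simp: M_def)
  have reflect: "M (A @ rev A) = S" if AB: "length A = m" "length B = m" "M (A @ B) = S" for A B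
  proof (cases "S = 0")
    case True
    have "M (A @ rev A) \<le> S" by (rule S_ge) (simp add: W_def that)
    then show ?thesis using True by (simp add: M_def)
  next
    case False
    have A: "nsq (P (rev A)) \<le> M (A @ rev A)"
      unfolding nsq_def M_def P_app P_star rev_rev_ident by (rule complex_Re_le_cmod)
    have "nsq (P B) \<le> M (rev B @ B)"
      unfolding nsq_def M_def P_app P_star rev_rev_ident by (rule complex_Re_le_cmod)
    also have "\<dots> \<le> S" by (rule S_ge) (simp add: W_def that)
    finally have B: "nsq (P B) \<le> S" .
    have "S\<^sup>2 \<le> nsq (P (rev A)) * nsq (P B)"
      using phi_cauchy_schwarz[of "P (rev A)" "P B"] AB(3) by (simp add: P_star M_def P_app)
    also have "\<dots> \<le> M (A @ rev A) * S"
      using A B nsq_nonneg by (intro mult_mono) (auto simp: M_def)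
    finally have "S \<le> M (A @ rev A)"
      using False S0 by (simp add: power2_eq_square)
    moreover have "M (A @ rev A) \<le> S" by (rule S_ge) (simp add: W_def that)
    ultimately show ?thesis by simp
  qed
  define R where "R r \<longleftrightarrow> (\<exists>j v. replicate r j @ v \<in> W \<and> M (replicate r j @ v) = S)" for r
  have big: "R (2 * m)" if r: "R r" "m \<le> r" for r
  proof -
    obtain j v where jv: "replicate r j @ v \<in> W" "M (replicate r j @ v) = S" using r R_def by blast
    have "replicate r j = replicate m j @ replicate (r - m) j"
      using r(2) by (simp flip: replicate_add)
    then have "M (replicate m j @ (replicate (r - m) j @ v)) = S" using jv by simp
    then have "M (replicate m j @ rev (replicate m j)) = S"
      by (rule reflect[rotated 2]) (use jv r in \<open>auto simp: W_def\<close>)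
    then show ?thesis
      unfolding R_def by (intro exI[of _ j] exI[of _ "[]"]) (simp add: W_def replicate_add mult_2)
  qed
  have dbl: "R (2 * r)" if r: "R r" "r \<le> m" for r
  proof -
    obtain j v where jv: "replicate r j @ v \<in> W" "M (replicate r j @ v) = S" using r R_def by blast
    define v1 where "v1 = take m v"
    define v2 where "v2 = drop m v"
    have v: "v = v1 @ v2" by (simp add: v1_def v2_def)
    have len: "length v1 = m" "length v2 = m - r" using jv(1) r by (auto simp: W_def v1_def v2_def)
    \<comment> \<open>The rotation puts the run at the end of the first half, so that the mirror
      image starts with the same run.\<close>
    have "M ((v2 @ replicate r j) @ v1) = S"
      using rot[of v2 "replicate r j @ v1"] jv(2) v by simp
    then have "M ((v2 @ replicate r j) @ rev (v2 @ replicate r j)) = S"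
      by (rule reflect[rotated 2]) (use len r in auto)
    then have "M (replicate (2 * r) j @ (rev v2 @ v2)) = S"
      using rot[of v2 "replicate r j @ replicate r j @ rev v2"] by (simp add: replicate_add mult_2)
    then show ?thesis
      unfolding R_def by (intro exI[of _ j] exI[of _ "rev v2 @ v2"]) (use len r in \<open>auto simp: W_def\<close>)
  qed
  have "R 1"
  proof -
    obtain j v where "w = j # v" using w(1) m by (cases w) (auto simp: W_def)
    then show ?thesis using w unfolding R_def by (intro exI[of _ j] exI[of _ v]) auto
  qed
  have "R (2 ^ k) \<or> R (2 * m)" for k
  proof (induction k)
    case (Suc k)
    then show ?case using big[of "2 ^ k"] dbl[of "2 ^ k"] by (cases "2 ^ k \<le> m") auto
  qed (use \<open>R 1\<close> in simp)
  \<comment> \<open>At most \<open>m\<close> doublings of a run of length 1 reach length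
    \<open>m\<close>, as \<open>m < 2 ^ m\<close>; one more reflection makes the whole word
    constant.\<close>
  then have "R (2 * m)" using big[of "2 ^ m"] by (metis less_exp less_imp_le)
  then obtain j v where jv: "replicate (2 * m) j @ v \<in> W" "M (replicate (2 * m) j @ v) = S"
    unfolding R_def by blast
  then have "M (replicate (2 * m) j) = S" by (auto simp: W_def)
  then have "S = cmod (phi (X j ^ (2 * m)))" by (simp add: M_def P_def)
  then show ?thesis using S_ge by (auto simp: W_def M_def P_def)
qed

end

text \<open>A letter \<open>(i, b)\<close> stands for the centered variable $Y_i$ if \<open>b\<close> is false and for the centered
  variable $Y_i^2 - 1$ if \<open>b\<close> is true.\<close>

locale free_family = nc_prob_space smul star phi
  for smul :: "complex \<Rightarrow> 'a::ring_1 \<Rightarrow> 'a" and star phi +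
  fixes Y :: "nat \<Rightarrow> 'a" and K :: real
  assumes free: "freely_independent smul star phi {1..} Y"
    and Y_star: "i \<ge> 1 \<Longrightarrow> star (Y i) = Y i"
    and Y_mean: "i \<ge> 1 \<Longrightarrow> phi (Y i) = 0"
    and Y_var: "i \<ge> 1 \<Longrightarrow> phi (Y i * Y i) = 1"
    and Y_fourth: "i \<ge> 1 \<Longrightarrow> phi (Y i * Y i * (Y i * Y i)) = complex_of_real (K + 1)"
    and K_ge: "K \<ge> 1"
begin

section \<open>Orthogonality of reduced words\<close>

definition alg :: "nat \<Rightarrow> 'a set" where
  "alg i = unital_star_subalgebra smul star hull {Y i}"

lemma alg_Y: "Y i \<in> alg i"
  and alg_one: "1 \<in> alg i"
  and alg_mult: "x \<in> alg i \<Longrightarrow> y \<in> alg i \<Longrightarrow> x * y \<in> alg i"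
  and alg_diff: "x \<in> alg i \<Longrightarrow> y \<in> alg i \<Longrightarrow> x - y \<in> alg i"
  and alg_smul: "x \<in> alg i \<Longrightarrow> smul c x \<in> alg i"
  unfolding alg_def hull_def unital_star_subalgebra_def
  by (blast intro: subspace_diff subspace_scale)+

text \<open>Each factor carries its index, and it may be any centered element of
  \<open>alg i\<close>. This generality is needed for the centered product of two letters in
  \<open>phi_word_step\<close>.\<close>

lemma phi_free_product:
  assumes "xs \<noteq> []" "\<And>l. l \<in> set xs \<Longrightarrow> fst l \<ge> 1 \<and> snd l \<in> alg (fst l) \<and> phi (snd l) = 0"
    and "distinct_adj (map fst xs)"
  shows "phi (prod_list (map snd xs)) = 0"
proof -
  have *: "map snd xs \<noteq> [] \<longrightarrow> length (map fst xs) = length (map snd xs) \<longrightarrow>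
        (\<forall>j<length (map snd xs). map fst xs ! j \<in> {1..} \<and> map snd xs ! j \<in> alg (map fst xs ! j) \<and> phi (map snd xs ! j) = 0) \<longrightarrow>
        (\<forall>j. Suc j < length (map snd xs) \<longrightarrow> map fst xs ! j \<noteq> map fst xs ! Suc j) \<longrightarrow>
        phi (prod_list (map snd xs)) = 0"
    using free unfolding freely_independent_def free_subalgebras_def alg_def[symmetric] by blast
  show ?thesis
    using * assms by (simp add: distinct_adj_conv_nth)
qed

definition letter :: "nat \<times> bool \<Rightarrow> 'a" where
  "letter l = (if snd l then Y (fst l) * Y (fst l) - 1 else Y (fst l))"

definition word :: "(nat \<times> bool) list \<Rightarrow> 'a" where
  "word w = prod_list (map letter w)"

definition reduced :: "(nat \<times> bool) list \<Rightarrow> bool" where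
  "reduced w \<longleftrightarrow> (\<forall>l\<in>set w. fst l \<ge> 1) \<and> distinct_adj (map fst w)"

lemma word_Nil [simp]: "word [] = 1"
  and word_Cons: "word (l # w) = letter l * word w"
  and word_append: "word (u @ v) = word u * word v"
  by (simp_all add: word_def)

lemma letter_in_alg: "letter (i, b) \<in> alg i"
  by (auto simp: letter_def intro: alg_Y alg_one alg_mult alg_diff)

lemma letter_mean: "fst l \<ge> 1 \<Longrightarrow> phi (letter l) = 0"
  by (simp add: letter_def Y_mean Y_var phi_diff phi_unital)

lemma letter_star: "fst l \<ge> 1 \<Longrightarrow> star (letter l) = letter l"
  by (simp add: letter_def Y_star star_diff star_mult)

lemma letter_square:
  assumes "fst l \<ge> 1"
  shows "phi (letter l * letter l) = (if snd l then K else 1)"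
proof -
  have "(Y i * Y i - 1) * (Y i * Y i - 1) = Y i * Y i * (Y i * Y i) - Y i * Y i - Y i * Y i + 1" for i
    by (simp add: algebra_simps)
  then show ?thesis
    using assms by (simp add: letter_def Y_var Y_fourth phi_diff phi_add phi_unital)
qed

lemma reduced_Cons: "reduced (l # w) \<longleftrightarrow> fst l \<ge> 1 \<and> reduced w \<and> (w = [] \<or> fst l \<noteq> fst (hd w))"
  by (cases w) (auto simp: reduced_def)

lemma word_star: "reduced w \<Longrightarrow> star (word w) = word (rev w)"
  by (induction w) (simp_all add: word_Cons word_append star_mult reduced_Cons letter_star)

lemma phi_reduced_word:
  assumes "reduced w" "w \<noteq> []"
  shows "phi (word w) = 0"
proof -
  have "phi (prod_list (map snd (map (\<lambda>l. (fst l, letter l)) w))) = 0"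
  proof (rule phi_free_product)
    fix l assume "l \<in> set (map (\<lambda>l. (fst l, letter l)) w)"
    then obtain k where "k \<in> set w" "l = (fst k, letter k)" by auto
    then show "fst l \<ge> 1 \<and> snd l \<in> alg (fst l) \<and> phi (snd l) = 0"
      using assms(1) letter_in_alg[of "fst k" "snd k"] letter_mean[of k] by (simp add: reduced_def)
  qed (use assms in \<open>simp_all add: reduced_def comp_def\<close>)
  then show ?thesis by (simp add: word_def comp_def)
qed

text \<open>The product of the two meeting letters is its mean plus a centered element
  \<open>t\<close> of the same subalgebra. The neighbours of \<open>t\<close> have other indices, so
  freeness kills its contribution and only the mean remains.\<close>

lemma phi_word_step:
  assumes u: "reduced (x # u)" and v: "reduced (y # v)" and eq: "fst x = fst y"
  shows "phi (word (rev (x # u)) * word (y # v)) = phi (letter x * letter y) * phi (word (rev u) * word v)"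
proof -
  define t where "t = letter x * letter y - smul (phi (letter x * letter y)) 1"
  let ?m = "map (\<lambda>l. (fst l, letter l))"
  have t: "t \<in> alg (fst x)" "phi t = 0"
  proof -
    have "letter x \<in> alg (fst x)" "letter y \<in> alg (fst x)"
      using letter_in_alg eq by (metis prod.collapse)+
    then show "t \<in> alg (fst x)" unfolding t_def by (intro alg_diff alg_mult alg_smul alg_one)
    show "phi t = 0" by (simp add: t_def phi_diff phi_smul phi_unital)
  qed
  have "phi (prod_list (map snd (?m (rev u) @ (fst x, t) # ?m v))) = 0"
  proof (rule phi_free_product)
    show "fst l \<ge> 1 \<and> snd l \<in> alg (fst l) \<and> phi (snd l) = 0" if "l \<in> set (?m (rev u) @ (fst x, t) # ?m v)" for l
      using that t u v by (auto simp: reduced_def letter_in_alg letter_mean)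
    have "distinct_adj (rev (map fst u) @ fst x # map fst v)"
      using u v eq unfolding distinct_adj_rev_append
      by (auto simp: reduced_def distinct_adj_Cons hd_map)
    then show "distinct_adj (map fst (?m (rev u) @ (fst x, t) # ?m v))"
      by (simp add: comp_def rev_map)
  qed simp
  then have 0: "phi (word (rev u) * (t * word v)) = 0" by (simp add: word_def comp_def)
  have "word (rev (x # u)) * word (y # v) = word (rev u) * ((letter x * letter y) * word v)"
    by (simp add: word_append word_Cons mult.assoc)
  also have "letter x * letter y = t + smul (phi (letter x * letter y)) 1" by (simp add: t_def)
  also have "word (rev u) * ((t + smul (phi (letter x * letter y)) 1) * word v) =
     word (rev u) * (t * word v) + smul (phi (letter x * letter y)) (word (rev u) * word v)"
    by (simp add: distrib_left distrib_right smul_mult_left smul_mult_right)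
  finally show ?thesis using 0 by (simp add: phi_add phi_smul)
qed

text \<open>Equal first indices are stripped by \<open>phi_word_step\<close>; at the first
  difference the concatenation is itself a reduced word, hence centered. Differing index lists are
  required: for words that differ only in the flags, the factor
  \<open>phi (letter x * letter y)\<close> involves the third moment.\<close>

lemma words_orthogonal:
  assumes "reduced u" "reduced v" "map fst u \<noteq> map fst v"
  shows "phi (word (rev u) * word v) = 0"
  using assms
proof (induction u arbitrary: v)
  case Nil
  then show ?case by (simp add: phi_reduced_word)
next
  case (Cons x u)
  show ?case
  proof (cases v)
    case Nil
    have "reduced (rev (x # u))" using Cons.prems(1)
      by (simp add: reduced_def distinct_adj_rev del: rev.simps flip: rev_map)
    then show ?thesis using Nil phi_reduced_word[of "rev (x # u)"] by simp
  next
    case v: (Cons y v')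
    show ?thesis
    proof (cases "fst x = fst y")
      case True
      have "phi (word (rev u) * word v') = 0"
        by (rule Cons.IH) (use Cons.prems v True in \<open>auto simp: reduced_Cons\<close>)
      then show ?thesis using phi_word_step[of x u y v'] Cons.prems v True by simp
    next
      case False
      have "distinct_adj (rev (map fst (x # u)) @ map fst v)"
        using Cons.prems v False
        by (simp add: distinct_adj_rev_append reduced_def del: rev.simps)
      then have "reduced (rev (x # u) @ v)"
        using Cons.prems unfolding reduced_def by (auto simp: rev_map)
      then show ?thesis
        using phi_reduced_word[of "rev (x # u) @ v"] by (simp add: word_append word_Cons mult.assoc)
    qed
  qed
qed

lemma nsq_word:
  assumes "reduced u"
  shows "nsq (word u) = K ^ length (filter snd u)"
proof -
  have "phi (word (rev u) * word u) = complex_of_real (K ^ length (filter snd u))"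
    using assms
  proof (induction u)
    case (Cons x u)
    then have "reduced u" "fst x \<ge> 1" by (simp_all add: reduced_Cons)
    then show ?case
      using Cons phi_word_step[of x u x u] letter_square[of x] by (simp del: rev.simps)
  qed (simp add: phi_unital)
  then show ?thesis by (simp add: nsq_def word_star[OF assms])
qed

section \<open>Normal ordering of a product of two words\<close>

definition merges :: "nat list \<Rightarrow> nat list \<Rightarrow> bool" where
  "merges p q \<longleftrightarrow> p \<noteq> [] \<and> q \<noteq> [] \<and> hd p = hd q"

text \<open>The normally ordered form of the product \<open>prod_list (map Y (rev p @ q))\<close>; a square $Y_a^2$ in the
  middle is replaced by $Y_a^2 - 1$.\<close>

definition nord :: "nat list \<Rightarrow> nat list \<Rightarrow> (nat \<times> bool) list" where
  "nord p q = (if merges p q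
     then map (\<lambda>i. (i, False)) (rev (tl p)) @ (hd q, True) # map (\<lambda>i. (i, False)) (tl q)
     else map (\<lambda>i. (i, False)) (rev p @ q))"

lemma map_fst_nord: "map fst (nord p q) = (if merges p q then rev (tl p) @ q else rev p @ q)"
  by (auto simp: nord_def merges_def comp_def)

lemma nord_Nil: "nord [] q = map (\<lambda>i. (i, False)) q"
  by (simp add: nord_def merges_def)

lemma reduced_nord:
  assumes "distinct_adj p" "distinct_adj q" "\<forall>i\<in>set p \<union> set q. i \<ge> 1"
  shows "reduced (nord p q)"
proof -
  have "distinct_adj (map fst (nord p q))"
    using assms unfolding map_fst_nord
    by (cases p) (auto simp: merges_def distinct_adj_rev_append distinct_adj_Cons)
  moreover have "set (map fst (nord p q)) \<subseteq> set p \<union> set q"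
    unfolding map_fst_nord by (cases p) (auto simp: merges_def)
  then have "\<forall>l\<in>set (nord p q). fst l \<ge> 1"
    using assms(3) by (metis image_eqI list.set_map subsetD)
  ultimately show ?thesis by (simp add: reduced_def)
qed

lemma nsq_nord:
  assumes "distinct_adj p" "distinct_adj q" "\<forall>i\<in>set p \<union> set q. i \<ge> 1"
  shows "nsq (word (nord p q)) = (if merges p q then K else 1)"
  using nsq_word[OF reduced_nord[OF assms]] by (simp add: nord_def filter_empty_conv)

text \<open>The parity of the length of a normally ordered word tells whether the middle letters merged.\<close>

lemma nord_inject:
  assumes len: "length q + length p' = length q' + length p"
    and eq: "map fst (nord p q) = map fst (nord p' q')"
  shows "p = p' \<and> q = q'"
proof -
  define e where "e p q = (if merges p q then 1 else 0 :: nat)" for p q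
  have l: "length (map fst (nord p q)) + e p q = length p + length q" for p q
    unfolding map_fst_nord e_def by (cases p) (simp_all add: merges_def)
  have "length p + length q + e p' q' = length p' + length q' + e p q"
    using l[of p q] l[of p' q'] unfolding eq by linarith
  then have "2 * length p + e p' q' = 2 * length p' + e p q" using len by linarith
  moreover have "2 * a + e p' q' = 2 * b + e p q \<Longrightarrow> merges p q = merges p' q' \<and> a = b" for a b
    unfolding e_def by (cases "merges p q"; cases "merges p' q'"; simp; presburger)
  ultimately have "merges p q = merges p' q' \<and> length p = length p'" by blast
  then have m: "merges p q = merges p' q'" and lp: "length p = length p'" "length q = length q'"
    using len by auto
  show ?thesis
  proof (cases "merges p q")
    case True
    then have "rev (tl p) @ q = rev (tl p') @ q'" using eq m unfolding map_fst_nord by simp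
    then have "tl p = tl p'" "q = q'" using lp by auto
    then show ?thesis using True m unfolding merges_def by (cases p; cases p') auto
  next
    case False
    then show ?thesis using eq m lp unfolding map_fst_nord by simp
  qed
qed

lemma nord_orthogonal:
  assumes "distinct_adj p" "distinct_adj q" "\<forall>i\<in>set p \<union> set q. i \<ge> 1"
    and "distinct_adj p'" "distinct_adj q'" "\<forall>i\<in>set p' \<union> set q'. i \<ge> 1"
    and "length q + length p' = length q' + length p" "(p, q) \<noteq> (p', q')"
  shows "phi (star (word (nord p q)) * word (nord p' q')) = 0"
proof -
  have red: "reduced (nord p q)" "reduced (nord p' q')"
    by (rule reduced_nord; fact)+
  have "map fst (nord p q) \<noteq> map fst (nord p' q')"
    using nord_inject[OF assms(7)] assms(8) by blast
  then show ?thesis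
    using words_orthogonal[OF red] by (simp add: word_star red)
qed

text \<open>When equal letters meet, $Y_a^2 = (Y_a^2 - 1) + 1$: the first summand stops with a
  merged letter, the second removes the pair and lets the next two letters meet. The index
  \<open>r\<close> counts the removed pairs.\<close>

lemma product_expansion:
  "prod_list (map Y (rev p)) * prod_list (map Y q) =
     (\<Sum>r\<le>length p. if r \<le> length q \<and> take r p = take r q then word (nord (drop r p) (drop r q)) else 0)"
proof (induction p arbitrary: q)
  case Nil
  show ?case by (simp add: nord_Nil word_def letter_def comp_def)
next
  case (Cons a p)
  have W: "word (map (\<lambda>i. (i, False)) w) = prod_list (map Y w)" for w
    by (simp add: word_def letter_def comp_def)
  show ?case
  proof (cases q)
    case Nil
    have "(\<Sum>r\<le>length p. if Suc r \<le> 0 then word (nord (drop (Suc r) (a # p)) (drop (Suc r) q)) else 0) = 0"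
      by simp
    then show ?thesis unfolding Nil
      by (subst length_Cons, subst sum.atMost_Suc_shift) (simp add: nord_def merges_def word_def letter_def comp_def)
  next
    case q: (Cons b q')
    have shift: "(\<Sum>r\<le>length (a # p). if r \<le> length q \<and> take r (a # p) = take r q then word (nord (drop r (a # p)) (drop r q)) else 0)
       = word (nord (a # p) q) + (if a = b then prod_list (map Y (rev p)) * prod_list (map Y q') else 0)"
      unfolding Cons.IH q length_Cons sum.atMost_Suc_shift by (auto intro!: sum.cong sum.neutral)
    show ?thesis
    proof (cases "a = b")
      case True
      have "prod_list (map Y (rev (a # p))) * prod_list (map Y q) =
         prod_list (map Y (rev p)) * (Y a * Y a) * prod_list (map Y q')"
        using True q by (simp add: mult.assoc)
      also have "Y a * Y a = letter (a, True) + 1" by (simp add: letter_def)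
      finally show ?thesis
        unfolding shift using True q
        by (simp add: nord_def merges_def word_append word_Cons W distrib_left distrib_right mult.assoc)
    next
      case False
      then show ?thesis unfolding shift using q
        by (simp add: nord_def merges_def word_def comp_def mult.assoc letter_def)
    qed
  qed
qed

end

section \<open>Contractions of kernels\<close>

lemma finite_multi_indices [simp]: "finite (multi_indices n k)"
  using finite_lists_length_eq[of "{1..n}" k] by (simp add: multi_indices_def conj_commute)

lemma multi_indices_0 [simp]: "multi_indices n 0 = {[]}"
  by (auto simp: multi_indices_def)

lemma multi_indices_length: "p \<in> multi_indices n k \<Longrightarrow> length p = k"
  and multi_indices_ge_1: "p \<in> multi_indices n k \<Longrightarrow> i \<in> set p \<Longrightarrow> i \<ge> 1"
  and rev_multi_indices: "p \<in> multi_indices n k \<Longrightarrow> rev p \<in> multi_indices n k"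
  and append_multi_indices: "p \<in> multi_indices n k \<Longrightarrow> q \<in> multi_indices n l \<Longrightarrow> p @ q \<in> multi_indices n (k + l)"
  by (auto simp: multi_indices_def)

lemma sum_multi_indices_append:
  "(\<Sum>x\<in>multi_indices n (k + l). h x) = (\<Sum>a\<in>multi_indices n k. \<Sum>b\<in>multi_indices n l. h (a @ b))"
proof -
  have "(\<Sum>a\<in>multi_indices n k. \<Sum>b\<in>multi_indices n l. h (a @ b)) =
      (\<Sum>(a, b)\<in>multi_indices n k \<times> multi_indices n l. h (a @ b))"
    by (rule sum.cartesian_product)
  also have "\<dots> = (\<Sum>x\<in>multi_indices n (k + l). h x)"
  proof (rule sum.reindex_bij_witness[of _ "\<lambda>x. (take k x, drop k x)" "\<lambda>(a, b). a @ b"])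
    fix x assume "x \<in> multi_indices n (k + l)"
    then show "(take k x, drop k x) \<in> multi_indices n k \<times> multi_indices n l"
      using set_take_subset[of k x] set_drop_subset[of k x] by (auto simp: multi_indices_def)
  qed (auto simp: multi_indices_def)
  finally show ?thesis ..
qed

lemma sum_multi_indices_rev:
  "(\<Sum>x\<in>multi_indices n k. h (rev x)) = (\<Sum>x\<in>multi_indices n k. h x)"
  by (rule sum.reindex_bij_witness[of _ rev rev]) (auto simp: rev_multi_indices)

text \<open>In a product the end of the left word meets the beginning of the right one. Since the
  left kernel will be summed over reversed words (\<open>hsum_rev\<close>), the contracted variables
  \<open>a\<close> stand first in both kernels.\<close>

definition contraction :: "nat \<Rightarrow> nat \<Rightarrow> (nat list \<Rightarrow> real) \<Rightarrow> (nat list \<Rightarrow> real) \<Rightarrow> nat list \<Rightarrow> nat list \<Rightarrow> real" where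
  "contraction n r f g p q = (\<Sum>a\<in>multi_indices n r. f (a @ p) * g (a @ q))"

definition kernel_nsq :: "nat \<Rightarrow> nat \<Rightarrow> (nat list \<Rightarrow> real) \<Rightarrow> real" where
  "kernel_nsq n k f = (\<Sum>p\<in>multi_indices n k. (f p)\<^sup>2)"

definition contraction_nsq ::
    "nat \<Rightarrow> nat \<Rightarrow> nat \<Rightarrow> (nat list \<Rightarrow> real) \<Rightarrow> nat \<Rightarrow> (nat list \<Rightarrow> real) \<Rightarrow> real" where
  "contraction_nsq n r k f l g =
     (\<Sum>p\<in>multi_indices n k. \<Sum>q\<in>multi_indices n l. (contraction n r f g p q)\<^sup>2)"

definition mirror_symmetric :: "nat \<Rightarrow> nat \<Rightarrow> (nat list \<Rightarrow> real) \<Rightarrow> bool" where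
  "mirror_symmetric n k f \<longleftrightarrow> (\<forall>p\<in>multi_indices n k. f (rev p) = f p)"

text \<open>The support condition under which only reduced words occur in a homogeneous sum.\<close>

definition adjacent_free :: "nat \<Rightarrow> nat \<Rightarrow> (nat list \<Rightarrow> real) \<Rightarrow> bool" where
  "adjacent_free n k f \<longleftrightarrow> (\<forall>p\<in>multi_indices n k. \<not> distinct_adj p \<longrightarrow> f p = 0)"

lemma kernel_nsq_nonneg: "0 \<le> kernel_nsq n k f"
  by (simp add: kernel_nsq_def sum_nonneg)

lemma contraction_nsq_nonneg: "0 \<le> contraction_nsq n r k f l g"
  by (simp add: contraction_nsq_def sum_nonneg)

lemma contraction_adjacent_free:
  assumes "adjacent_free n (r + k) f" "adjacent_free n (r + l) g"
    and "p \<in> multi_indices n k" "q \<in> multi_indices n l" "\<not> distinct_adj p \<or> \<not> distinct_adj q"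
  shows "contraction n r f g p q = 0"
  unfolding contraction_def
proof (rule sum.neutral, rule ballI)
  fix a assume a: "a \<in> multi_indices n r"
  have "\<not> distinct_adj (a @ p) \<or> \<not> distinct_adj (a @ q)"
    using assms(5) by (auto simp: distinct_adj_append_iff)
  then show "f (a @ p) * g (a @ q) = 0"
    using append_multi_indices[OF a assms(3)] append_multi_indices[OF a assms(4)] assms(1,2)
    unfolding adjacent_free_def by auto
qed

text \<open>Cauchy--Schwarz applied to the two Gram matrices obtained by exchanging the contracted and the
  free variables; the Gram matrix of \<open>f\<close> is again a contraction of \<open>f\<close> with itself.\<close>

lemma contraction_nsq_le:
  assumes f: "mirror_symmetric n (r + k) f"
  shows "contraction_nsq n r k f l c \<le> sqrt (contraction_nsq n k r f r f) * kernel_nsq n (r + l) c"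
proof -
  let ?I = "multi_indices n"
  define A where "A = (\<lambda>(a, a'). \<Sum>p\<in>?I k. f (a @ p) * f (a' @ p))"
  define B where "B = (\<lambda>(a, a'). \<Sum>q\<in>?I l. c (a @ q) * c (a' @ q))"
  have "contraction_nsq n r k f l c = (\<Sum>p\<in>?I k. \<Sum>q\<in>?I l. \<Sum>a\<in>?I r. \<Sum>a'\<in>?I r.
      (f (a @ p) * f (a' @ p)) * (c (a @ q) * c (a' @ q)))"
    unfolding contraction_nsq_def contraction_def power2_eq_square sum_product
    by (intro sum.cong refl) (simp only: ac_simps)
  also have "\<dots> = (\<Sum>p\<in>?I k. \<Sum>a\<in>?I r. \<Sum>a'\<in>?I r. (f (a @ p) * f (a' @ p)) * B (a, a'))"
  proof (rule sum.cong[OF refl])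
    fix p
    have "(\<Sum>q\<in>?I l. \<Sum>a\<in>?I r. \<Sum>a'\<in>?I r. (f (a @ p) * f (a' @ p)) * (c (a @ q) * c (a' @ q))) =
       (\<Sum>a\<in>?I r. \<Sum>q\<in>?I l. \<Sum>a'\<in>?I r. (f (a @ p) * f (a' @ p)) * (c (a @ q) * c (a' @ q)))"
      by (rule sum.swap)
    also have "\<dots> = (\<Sum>a\<in>?I r. \<Sum>a'\<in>?I r. \<Sum>q\<in>?I l. (f (a @ p) * f (a' @ p)) * (c (a @ q) * c (a' @ q)))"
      by (rule sum.cong[OF refl], rule sum.swap)
    finally show "(\<Sum>q\<in>?I l. \<Sum>a\<in>?I r. \<Sum>a'\<in>?I r. (f (a @ p) * f (a' @ p)) * (c (a @ q) * c (a' @ q))) =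
       (\<Sum>a\<in>?I r. \<Sum>a'\<in>?I r. (f (a @ p) * f (a' @ p)) * B (a, a'))"
      by (simp only: B_def prod.case sum_distrib_left)
  qed
  also have "\<dots> = (\<Sum>a\<in>?I r. \<Sum>p\<in>?I k. \<Sum>a'\<in>?I r. (f (a @ p) * f (a' @ p)) * B (a, a'))"
    by (rule sum.swap)
  also have "\<dots> = (\<Sum>a\<in>?I r. \<Sum>a'\<in>?I r. \<Sum>p\<in>?I k. (f (a @ p) * f (a' @ p)) * B (a, a'))"
    by (rule sum.cong[OF refl], rule sum.swap)
  also have "\<dots> = (\<Sum>a\<in>?I r. \<Sum>a'\<in>?I r. A (a, a') * B (a, a'))"
    by (simp only: A_def prod.case sum_distrib_right)
  also have "\<dots> = (\<Sum>x\<in>?I r \<times> ?I r. A x * B x)"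
    by (rule sum.cartesian_product'[symmetric])
  finally have eq: "contraction_nsq n r k f l c = (\<Sum>x\<in>?I r \<times> ?I r. A x * B x)" .
  \<comment> \<open>In \<open>A\<close> the summed variables stand last, in a contraction first;
    mirror symmetry turns the arguments around.\<close>
  have "(\<Sum>x\<in>?I r \<times> ?I r. (A x)\<^sup>2) = (\<Sum>a\<in>?I r. \<Sum>a'\<in>?I r. (A (rev a, rev a'))\<^sup>2)"
    unfolding sum.cartesian_product' sum_multi_indices_rev[where h = "\<lambda>a. \<Sum>a'\<in>?I r. (A (a, rev a'))\<^sup>2"]
    by (intro sum.cong refl sum_multi_indices_rev[symmetric])
  also have "\<dots> = contraction_nsq n k r f r f"
    unfolding contraction_nsq_def
  proof (intro sum.cong refl arg_cong[where f = "\<lambda>x. x\<^sup>2"])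
    fix a a' assume a: "a \<in> ?I r" "a' \<in> ?I r"
    have m: "f (rev b @ rev p) = f (p @ b)" if "b \<in> ?I r" "p \<in> ?I k" for b p
      using f append_multi_indices[OF that(2,1)] unfolding mirror_symmetric_def
      by (metis add.commute rev_append)
    have "A (rev a, rev a') = (\<Sum>p\<in>?I k. f (rev a @ rev p) * f (rev a' @ rev p))"
      unfolding A_def prod.case by (rule sum_multi_indices_rev[symmetric])
    also have "\<dots> = contraction n k f f a a'"
      unfolding contraction_def by (intro sum.cong refl) (simp add: m a)
    finally show "A (rev a, rev a') = contraction n k f f a a'" .
  qed
  finally have A: "(\<Sum>x\<in>?I r \<times> ?I r. (A x)\<^sup>2) = contraction_nsq n k r f r f" .
  \<comment> \<open>The entries of the Gram matrix \<open>B\<close> are bounded by products of row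
    norms, and the squared row norms add up to the norm of the kernel.\<close>
  define s where "s a = (\<Sum>q\<in>?I l. (c (a @ q))\<^sup>2)" for a
  have "(\<Sum>x\<in>?I r \<times> ?I r. (B x)\<^sup>2) \<le> (\<Sum>x\<in>?I r \<times> ?I r. s (fst x) * s (snd x))"
  proof (rule sum_mono)
    fix x
    show "(B x)\<^sup>2 \<le> s (fst x) * s (snd x)"
      unfolding B_def s_def split_def by (rule Cauchy_Schwarz_ineq_sum)
  qed
  also have "\<dots> = (\<Sum>a\<in>?I r. s a) * (\<Sum>a\<in>?I r. s a)"
    unfolding sum_product sum.cartesian_product' by simp
  also have "(\<Sum>a\<in>?I r. s a) = kernel_nsq n (r + l) c"
    unfolding kernel_nsq_def s_def by (rule sum_multi_indices_append[symmetric])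
  finally have B: "(\<Sum>x\<in>?I r \<times> ?I r. (B x)\<^sup>2) \<le> (kernel_nsq n (r + l) c)\<^sup>2"
    by (simp only: power2_eq_square)
  have "(contraction_nsq n r k f l c)\<^sup>2 \<le> contraction_nsq n k r f r f * (\<Sum>x\<in>?I r \<times> ?I r. (B x)\<^sup>2)"
    unfolding eq A[symmetric] by (rule Cauchy_Schwarz_ineq_sum)
  also have "\<dots> \<le> contraction_nsq n k r f r f * (kernel_nsq n (r + l) c)\<^sup>2"
    by (rule mult_left_mono[OF B contraction_nsq_nonneg])
  also have "\<dots> = (sqrt (contraction_nsq n k r f r f) * kernel_nsq n (r + l) c)\<^sup>2"
    by (simp add: power_mult_distrib contraction_nsq_nonneg)
  finally show ?thesis
    by (rule power2_le_imp_le) (simp add: contraction_nsq_nonneg kernel_nsq_nonneg)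
qed

text \<open>Reversing \<open>p\<close> moves the fixed index \<open>b\<close> to the end, which
  exhibits the sum as the entry at \<open>[b]\<close>, \<open>[b]\<close> of a contraction; one
  entry is at most the Hilbert--Schmidt norm. No range is imposed on \<open>b\<close>, as it will be
  the head of an arbitrary list.\<close>

lemma influence_le:
  assumes f: "mirror_symmetric n (Suc k) f"
  shows "(\<Sum>p\<in>{p\<in>multi_indices n (Suc k). hd p = b}. (f p)\<^sup>2) \<le> sqrt (contraction_nsq n k 1 f 1 f)"
proof (cases "b \<in> {1..n}")
  case False
  have "{p\<in>multi_indices n (Suc k). hd p = b} = {}"
    using False by (auto simp: multi_indices_def length_Suc_conv)
  then show ?thesis by (simp only: sum.empty real_sqrt_ge_zero contraction_nsq_nonneg)
next
  case True
  let ?c = "contraction n k f f [b] [b]"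
  have b: "[b] \<in> multi_indices n 1" using True by (simp add: multi_indices_def)
  have "(\<Sum>p\<in>{p\<in>multi_indices n (Suc k). hd p = b}. (f p)\<^sup>2) = (\<Sum>a\<in>multi_indices n k. (f (b # rev a))\<^sup>2)"
    by (rule sum.reindex_bij_witness[of _ "\<lambda>a. b # rev a" "\<lambda>p. rev (tl p)"])
       (use True in \<open>auto simp: multi_indices_def length_Suc_conv\<close>)
  also have "\<dots> = ?c"
    unfolding contraction_def
  proof (rule sum.cong[OF refl])
    fix a assume a: "a \<in> multi_indices n k"
    have "a @ [b] \<in> multi_indices n (Suc k)" using append_multi_indices[OF a b] by simp
    then have "f (rev (a @ [b])) = f (a @ [b])" using f unfolding mirror_symmetric_def by blast
    then show "(f (b # rev a))\<^sup>2 = f (a @ [b]) * f (a @ [b])" by (simp add: power2_eq_square)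
  qed
  also have "?c \<le> sqrt (contraction_nsq n k 1 f 1 f)"
  proof (rule real_le_rsqrt)
    have "?c\<^sup>2 \<le> (\<Sum>q\<in>multi_indices n 1. (contraction n k f f [b] q)\<^sup>2)"
      by (rule member_le_sum[OF b]) simp_all
    also have "\<dots> \<le> contraction_nsq n k 1 f 1 f"
      unfolding contraction_nsq_def by (rule member_le_sum[OF b]) (simp_all add: sum_nonneg)
    finally show "?c\<^sup>2 \<le> contraction_nsq n k 1 f 1 f" .
  qed
  finally show ?thesis .
qed

context free_family
begin

section \<open>Products of homogeneous sums and their norms\<close>

abbreviation hsum :: "nat \<Rightarrow> nat \<Rightarrow> (nat list \<Rightarrow> real) \<Rightarrow> 'a" where
  "hsum \<equiv> homogeneous_sum smul Y"

text \<open>The double sums over \<open>p\<close> and \<open>q\<close> below range over the free variables that remain after \<open>r\<close> of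
  the variables of a kernel of degree \<open>d\<close> have been contracted with one of degree \<open>m\<close>.\<close>

definition nord_sum :: "nat \<Rightarrow> nat \<Rightarrow> nat \<Rightarrow> (nat \<Rightarrow> nat list \<Rightarrow> nat list \<Rightarrow> real) \<Rightarrow> 'a" where
  "nord_sum n d m k = (\<Sum>r\<le>d. \<Sum>p\<in>multi_indices n (d - r). \<Sum>q\<in>multi_indices n (m - r).
      smul (complex_of_real (k r p q)) (word (nord p q)))"

lemma nord_sum_diff: "nord_sum n d m k - nord_sum n d m k' = nord_sum n d m (\<lambda>r p q. k r p q - k' r p q)"
  by (simp add: nord_sum_def sum_subtractf scale_left_diff_distrib)

lemma word_False: "word (map (\<lambda>i. (i, False)) p) = prod_list (map Y p)"
  by (simp add: word_def letter_def comp_def)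

text \<open>Pythagoras: by \<open>van\<close> only pairs giving reduced words matter, and the words
  of different triples \<open>(r, p, q)\<close> are orthogonal.\<close>

lemma nsq_nord_sum:
  assumes "d \<le> m"
    and van: "\<And>r p q. r \<le> d \<Longrightarrow> p \<in> multi_indices n (d - r) \<Longrightarrow> q \<in> multi_indices n (m - r) \<Longrightarrow>
        \<not> distinct_adj p \<or> \<not> distinct_adj q \<Longrightarrow> k r p q = 0"
  shows "nsq (nord_sum n d m k) = (\<Sum>r\<le>d. \<Sum>p\<in>multi_indices n (d - r). \<Sum>q\<in>multi_indices n (m - r).
      (k r p q)\<^sup>2 * (if merges p q then K else 1))"
proof -
  define S where "S = (SIGMA r:{..d}. multi_indices n (d - r) \<times> multi_indices n (m - r))"
  define S' where "S' = {(r, p, q) \<in> S. distinct_adj p \<and> distinct_adj q}"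
  have fin: "finite S" unfolding S_def by (intro finite_SigmaI) auto
  then have fin': "finite S'" unfolding S'_def by (rule rev_finite_subset) auto
  have nest: "(\<Sum>r\<le>d. \<Sum>p\<in>multi_indices n (d - r). \<Sum>q\<in>multi_indices n (m - r). h (r, p, q)) = (\<Sum>x\<in>S. h x)"
    for h :: "nat \<times> nat list \<times> nat list \<Rightarrow> 'z::comm_monoid_add"
    unfolding S_def sum.cartesian_product by (subst sum.Sigma) (auto simp: split_def)
  have restr: "(\<Sum>x\<in>S. h x) = (\<Sum>x\<in>S'. h x)"
    if "\<And>r p q. (r, p, q) \<in> S - S' \<Longrightarrow> h (r, p, q) = 0"
    for h :: "nat \<times> nat list \<times> nat list \<Rightarrow> 'z::comm_monoid_add"
    by (rule sum.mono_neutral_right) (use fin that in \<open>auto simp: S'_def\<close>)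
  have k0: "k r p q = 0" if "(r, p, q) \<in> S - S'" for r p q
    by (rule van) (use that in \<open>auto simp: S_def S'_def\<close>)
  define e where "e = (\<lambda>(r :: nat, p, q). word (nord p q))"
  define k' where "k' = (\<lambda>(r, p, q). k r p q)"
  have mem: "r \<le> d \<and> length p = d - r \<and> length q = m - r \<and> distinct_adj p \<and> distinct_adj q \<and>
      (\<forall>i\<in>set p \<union> set q. i \<ge> 1)" if "(r, p, q) \<in> S'" for r p q
    using that multi_indices_length multi_indices_ge_1 unfolding S'_def S_def by fastforce
  have "nord_sum n d m k = (\<Sum>x\<in>S. smul (complex_of_real (k' x)) (e x))"
    unfolding nord_sum_def nest[symmetric] k'_def e_def prod.case ..
  also have "\<dots> = (\<Sum>x\<in>S'. smul (complex_of_real (k' x)) (e x))"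
    by (rule restr) (simp add: k'_def k0)
  finally have "nsq (nord_sum n d m k) = nsq (\<Sum>x\<in>S'. smul (complex_of_real (k' x)) (e x))" by simp
  also have "\<dots> = (\<Sum>x\<in>S'. (k' x)\<^sup>2 * nsq (e x))"
  proof (rule nsq_orthogonal_sum[OF fin'])
    fix x y assume xy: "x \<in> S'" "y \<in> S'" "x \<noteq> y"
    obtain r p q r' p' q' where x: "x = (r, p, q)" and y: "y = (r', p', q')" by (cases x, cases y) auto
    note mx = mem[OF xy(1)[unfolded x]] and my = mem[OF xy(2)[unfolded y]]
    \<comment> \<open>The two lengths always differ by \<open>m - d\<close>, whatever
      \<open>r\<close> is; and since the length of \<open>p\<close> determines \<open>r\<close>,
      different triples have different pairs.\<close>
    have "length q + length p' = length q' + length p" using mx my assms(1) by auto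
    moreover have "(p, q) \<noteq> (p', q')" using mx my xy(3) x y by auto
    ultimately have "phi (star (word (nord p q)) * word (nord p' q')) = 0"
      using mx my by (intro nord_orthogonal) blast+
    then show "phi (star (e x) * e y) = 0" by (simp add: e_def x y)
  qed
  also have "\<dots> = (\<Sum>x\<in>S'. case x of (r, p, q) \<Rightarrow> (k r p q)\<^sup>2 * (if merges p q then K else 1))"
  proof (rule sum.cong[OF refl])
    fix x assume x: "x \<in> S'"
    obtain r p q where xx: "x = (r, p, q)" by (cases x)
    have "nsq (word (nord p q)) = (if merges p q then K else 1)"
      by (rule nsq_nord) (use mem x xx in blast)+
    then show "(k' x)\<^sup>2 * nsq (e x) = (case x of (r, p, q) \<Rightarrow> (k r p q)\<^sup>2 * (if merges p q then K else 1))"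
      by (simp add: xx k'_def e_def)
  qed
  also have "\<dots> = (\<Sum>x\<in>S. case x of (r, p, q) \<Rightarrow> (k r p q)\<^sup>2 * (if merges p q then K else 1))"
    by (rule restr[symmetric]) (simp add: k0)
  finally show ?thesis unfolding nest[symmetric] prod.case .
qed

lemma hsum_rev:
  assumes "mirror_symmetric n d f"
  shows "hsum n d f = (\<Sum>p\<in>multi_indices n d. smul (complex_of_real (f p)) (prod_list (map Y (rev p))))"
proof -
  have "hsum n d f = (\<Sum>p\<in>multi_indices n d. smul (complex_of_real (f (rev p))) (prod_list (map Y (rev p))))"
    unfolding homogeneous_sum_def by (rule sum_multi_indices_rev[symmetric])
  then show ?thesis using assms by (simp add: mirror_symmetric_def)
qed

lemma star_hsum:
  assumes "mirror_symmetric n d f"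
  shows "star (hsum n d f) = hsum n d f"
proof -
  have "star (prod_list (map Y p)) = prod_list (map Y (rev p))" if "p \<in> multi_indices n d" for p
  proof -
    have "map star (map Y p) = map Y p" using that multi_indices_ge_1 Y_star by (auto simp del: map_map intro!: map_idI)
    then show ?thesis by (simp only: star_prod_list rev_map)
  qed
  then show ?thesis
    unfolding hsum_rev[OF assms] by (subst hsum_rev[OF assms, symmetric])
      (simp add: homogeneous_sum_def star_sum star_smul)
qed

text \<open>Writing the left factor over reversed words brings each summand into the form of
  \<open>product_expansion\<close>; summing out the common prefix of length \<open>r\<close>
  produces the contraction.\<close>

lemma hsum_mult:
  assumes "d \<le> m" and f: "mirror_symmetric n d f"
  shows "hsum n d f * hsum n m c = nord_sum n d m (\<lambda>r. contraction n r f c)"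
proof -
  let ?I = "multi_indices n"
  let ?W = "\<lambda>r p q. if take r p = take r q then smul (complex_of_real (f p * c q)) (word (nord (drop r p) (drop r q))) else 0"
  have "hsum n d f * hsum n m c = (\<Sum>p\<in>?I d. \<Sum>q\<in>?I m. \<Sum>r\<le>d. ?W r p q)"
    unfolding hsum_rev[OF f] unfolding homogeneous_sum_def sum_product
  proof (intro sum.cong refl)
    fix p q assume p: "p \<in> ?I d" and q: "q \<in> ?I m"
    have len: "length p = d" "length q = m" using p q by (simp_all add: multi_indices_length)
    have "smul (complex_of_real (f p)) (prod_list (map Y (rev p))) * smul (complex_of_real (c q)) (prod_list (map Y q))
        = smul (complex_of_real (f p * c q)) (prod_list (map Y (rev p)) * prod_list (map Y q))"
      by (simp add: smul_mult_left smul_mult_right)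
    also have "\<dots> = (\<Sum>r\<le>d. ?W r p q)"
      unfolding product_expansion scale_sum_right len
      by (intro sum.cong refl) (use assms(1) in auto)
    finally show "smul (complex_of_real (f p)) (prod_list (map Y (rev p))) * smul (complex_of_real (c q)) (prod_list (map Y q))
        = (\<Sum>r\<le>d. ?W r p q)" .
  qed
  also have "\<dots> = (\<Sum>p\<in>?I d. \<Sum>r\<le>d. \<Sum>q\<in>?I m. ?W r p q)"
    by (rule sum.cong[OF refl], rule sum.swap)
  also have "\<dots> = (\<Sum>r\<le>d. \<Sum>p\<in>?I d. \<Sum>q\<in>?I m. ?W r p q)"
    by (rule sum.swap)
  also have "\<dots> = nord_sum n d m (\<lambda>r. contraction n r f c)"
    unfolding nord_sum_def
  proof (rule sum.cong[OF refl])
    fix r assume "r \<in> {..d}"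
    then have r: "d = r + (d - r)" "m = r + (m - r)" using assms(1) by auto
    let ?V = "\<lambda>a p b q. if a = b then smul (complex_of_real (f (a @ p) * c (b @ q))) (word (nord p q)) else 0"
    have "(\<Sum>p\<in>?I d. \<Sum>q\<in>?I m. ?W r p q) = (\<Sum>p\<in>?I (r + (d - r)). \<Sum>q\<in>?I (r + (m - r)). ?W r p q)"
      using r by simp
    also have "\<dots> = (\<Sum>a\<in>?I r. \<Sum>p\<in>?I (d - r). \<Sum>b\<in>?I r. \<Sum>q\<in>?I (m - r). ?V a p b q)"
      unfolding sum_multi_indices_append
      by (intro sum.cong refl) (simp add: multi_indices_length)
    also have "\<dots> = (\<Sum>p\<in>?I (d - r). \<Sum>a\<in>?I r. \<Sum>b\<in>?I r. \<Sum>q\<in>?I (m - r). ?V a p b q)"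
      by (rule sum.swap)
    also have "\<dots> = (\<Sum>p\<in>?I (d - r). \<Sum>a\<in>?I r. \<Sum>q\<in>?I (m - r). \<Sum>b\<in>?I r. ?V a p b q)"
      by (rule sum.cong[OF refl], rule sum.cong[OF refl], rule sum.swap)
    also have "\<dots> = (\<Sum>p\<in>?I (d - r). \<Sum>q\<in>?I (m - r). \<Sum>a\<in>?I r. \<Sum>b\<in>?I r. ?V a p b q)"
      by (rule sum.cong[OF refl], rule sum.swap)
    also have "\<dots> = (\<Sum>p\<in>?I (d - r). \<Sum>q\<in>?I (m - r). smul (complex_of_real (contraction n r f c p q)) (word (nord p q)))"
      by (simp add: contraction_def scale_sum_left)
    finally show "(\<Sum>p\<in>?I d. \<Sum>q\<in>?I m. ?W r p q) =
      (\<Sum>p\<in>?I (d - r). \<Sum>q\<in>?I (m - r). smul (complex_of_real (contraction n r f c p q)) (word (nord p q)))" .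
  qed
  finally show ?thesis .
qed

end

section \<open>The fourth moment and the annihilation-creation error\<close>

text \<open>A tensor product may have equal indices at the seam of its factors, where the word is
  not reduced. The cut drops these terms; their total is controlled by influences.\<close>

definition adjacent_cut :: "(nat list \<Rightarrow> real) \<Rightarrow> nat list \<Rightarrow> real" where
  "adjacent_cut F q = (if distinct_adj q then F q else 0)"

definition tensor :: "nat \<Rightarrow> (nat list \<Rightarrow> real) \<Rightarrow> (nat list \<Rightarrow> real) \<Rightarrow> nat list \<Rightarrow> real" where
  "tensor d f F q = f (take d q) * F (drop d q)"

lemma adjacent_free_cut: "adjacent_free n k (adjacent_cut F)"
  by (simp add: adjacent_free_def adjacent_cut_def)

lemma kernel_nsq_cut_le: "kernel_nsq n k (adjacent_cut F) \<le> kernel_nsq n k F"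
  unfolding kernel_nsq_def by (rule sum_mono) (simp add: adjacent_cut_def)

lemma kernel_nsq_tensor: "kernel_nsq n (d + l) (tensor d f F) = kernel_nsq n d f * kernel_nsq n l F"
  unfolding kernel_nsq_def sum_multi_indices_append sum_product
  by (intro sum.cong refl) (simp add: tensor_def multi_indices_length power_mult_distrib)

context free_family
begin

text \<open>This is where the sign of the fourth cumulant acts: because \<open>K \<ge> 1\<close>,
  merged words do not lower the norm.\<close>

lemma nsq_nord_sum_ge:
  assumes "d \<le> m"
    and "\<And>r p q. r \<le> d \<Longrightarrow> p \<in> multi_indices n (d - r) \<Longrightarrow> q \<in> multi_indices n (m - r) \<Longrightarrow>
        \<not> distinct_adj p \<or> \<not> distinct_adj q \<Longrightarrow> k r p q = 0"
  shows "(\<Sum>r\<le>d. \<Sum>p\<in>multi_indices n (d - r). \<Sum>q\<in>multi_indices n (m - r). (k r p q)\<^sup>2) \<le> nsq (nord_sum n d m k)"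
proof -
  have "x\<^sup>2 \<le> x\<^sup>2 * (if b then K else 1)" for b and x :: real
    using K_ge mult_left_mono[of 1 K "x\<^sup>2"] by simp
  moreover have eq: "nsq (nord_sum n d m k) = (\<Sum>r\<le>d. \<Sum>p\<in>multi_indices n (d - r). \<Sum>q\<in>multi_indices n (m - r).
      (k r p q)\<^sup>2 * (if merges p q then K else 1))"
    by (rule nsq_nord_sum) (use assms in blast)+
  ultimately show ?thesis
    unfolding eq by (intro sum_mono)
qed

lemma nsq_nord_sum_le:
  assumes "d \<le> m"
    and "\<And>r p q. r \<le> d \<Longrightarrow> p \<in> multi_indices n (d - r) \<Longrightarrow> q \<in> multi_indices n (m - r) \<Longrightarrow>
        \<not> distinct_adj p \<or> \<not> distinct_adj q \<Longrightarrow> k r p q = 0"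
  shows "nsq (nord_sum n d m k) \<le> K * (\<Sum>r\<le>d. \<Sum>p\<in>multi_indices n (d - r). \<Sum>q\<in>multi_indices n (m - r). (k r p q)\<^sup>2)"
proof -
  have "x\<^sup>2 * (if b then K else 1) \<le> K * x\<^sup>2" for b and x :: real
    using K_ge mult_right_mono[of 1 K "x\<^sup>2"] by simp
  moreover have eq: "nsq (nord_sum n d m k) = (\<Sum>r\<le>d. \<Sum>p\<in>multi_indices n (d - r). \<Sum>q\<in>multi_indices n (m - r).
      (k r p q)\<^sup>2 * (if merges p q then K else 1))"
    by (rule nsq_nord_sum) (use assms in blast)+
  ultimately show ?thesis
    unfolding eq sum_distrib_left by (intro sum_mono)
qed

lemma phi_nord:
  assumes "p \<in> multi_indices n k" "q \<in> multi_indices n l" "distinct_adj p" "distinct_adj q" "p \<noteq> [] \<or> q \<noteq> []"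
  shows "phi (word (nord p q)) = 0"
proof (rule phi_reduced_word)
  show "reduced (nord p q)"
    by (rule reduced_nord) (use assms multi_indices_ge_1 in blast)+
  show "nord p q \<noteq> []" using assms(5) by (auto simp: nord_def)
qed

text \<open>Only the full contraction \<open>r = d\<close> leaves the empty word; every other word
  is centered. Covariances thus become inner products of kernels.\<close>

lemma phi_hsum_mult:
  assumes "mirror_symmetric n d f" "adjacent_free n d f" "adjacent_free n d g"
  shows "phi (hsum n d f * hsum n d g) = complex_of_real (\<Sum>p\<in>multi_indices n d. f p * g p)"
proof -
  let ?I = "multi_indices n"
  let ?t = "\<lambda>r. \<Sum>p\<in>?I (d - r). \<Sum>q\<in>?I (d - r).
      complex_of_real (contraction n r f g p q) * phi (word (nord p q))"
  have "phi (hsum n d f * hsum n d g) = (\<Sum>r\<le>d. ?t r)"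
    by (simp add: hsum_mult[OF order_refl assms(1)] nord_sum_def phi_sum phi_smul)
  also have "\<dots> = (\<Sum>r\<in>{d}. ?t r)"
  proof (rule sum.mono_neutral_right; (intro ballI)?)
    fix r assume "r \<in> {..d} - {d}"
    then have r: "r < d" by auto
    show "?t r = 0"
    proof (intro sum.neutral ballI)
      fix p q assume pq: "p \<in> ?I (d - r)" "q \<in> ?I (d - r)"
      show "complex_of_real (contraction n r f g p q) * phi (word (nord p q)) = 0"
      proof (cases "distinct_adj p \<and> distinct_adj q")
        case True
        have "p \<noteq> []" using pq r by (auto simp: multi_indices_def)
        then show ?thesis using phi_nord[OF pq] True by simp
      next
        case False
        have "contraction n r f g p q = 0"
          by (rule contraction_adjacent_free[of n r "d - r" f "d - r"]) (use assms r pq False in auto)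
        then show ?thesis by simp
      qed
    qed
  qed auto
  also have "\<dots> = complex_of_real (contraction n d f g [] [])"
    by (simp add: nord_Nil phi_unital)
  finally show ?thesis by (simp add: contraction_def)
qed

text \<open>The two extreme contractions \<open>r = 0\<close> and \<open>r = d\<close> both contribute the square of the variance.\<close>

lemma fourth_moment_ge:
  assumes "d \<ge> 1" and f: "mirror_symmetric n d f" "adjacent_free n d f"
  shows "2 * (kernel_nsq n d f)\<^sup>2 + (\<Sum>r\<in>{1..<d}. contraction_nsq n r (d - r) f (d - r) f)
     \<le> Re (phi (hsum n d f ^ 4))"
proof -
  let ?X = "hsum n d f" and ?c = "\<lambda>r. contraction_nsq n r (d - r) f (d - r) f"
  have "star (?X * ?X) * (?X * ?X) = ?X ^ 4"
    by (simp add: star_mult star_hsum[OF f(1)] power4_eq_xxxx mult.assoc)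
  then have X4: "Re (phi (?X ^ 4)) = nsq (?X * ?X)" by (simp add: nsq_def)
  have c0: "?c 0 = (kernel_nsq n d f)\<^sup>2"
    by (simp add: contraction_nsq_def contraction_def kernel_nsq_def power2_eq_square sum_product ac_simps)
  have cd: "?c d = (kernel_nsq n d f)\<^sup>2"
    by (simp add: contraction_nsq_def contraction_def kernel_nsq_def power2_eq_square)
  have "{..d} = insert 0 (insert d {1..<d})" using assms(1) by auto
  then have "(\<Sum>r\<le>d. ?c r) = ?c 0 + (?c d + (\<Sum>r\<in>{1..<d}. ?c r))"
    using assms(1) by simp
  then have "2 * (kernel_nsq n d f)\<^sup>2 + (\<Sum>r\<in>{1..<d}. ?c r) = (\<Sum>r\<le>d. ?c r)"
    unfolding c0 cd by simp
  also have "\<dots> \<le> nsq (nord_sum n d d (\<lambda>r. contraction n r f f))"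
    unfolding contraction_nsq_def
  proof (rule nsq_nord_sum_ge[OF order_refl])
    fix r p q assume "r \<le> d" "p \<in> multi_indices n (d - r)" "q \<in> multi_indices n (d - r)"
      "\<not> distinct_adj p \<or> \<not> distinct_adj q"
    then show "contraction n r f f p q = 0"
      by (intro contraction_adjacent_free[of n r "d - r" f "d - r"]) (use f in auto)
  qed
  finally show ?thesis unfolding X4 hsum_mult[OF order_refl f(1)] .
qed

text \<open>Norms rather than their squares are summed, since \<open>contraction_nsq_le\<close> and
  \<open>influence_le\<close> bound squared quantities by a first power of these norms.\<close>

definition contraction_defect :: "nat \<Rightarrow> nat \<Rightarrow> (nat list \<Rightarrow> real) \<Rightarrow> real" where
  "contraction_defect n d f = (\<Sum>r\<in>{1..<d}. sqrt (contraction_nsq n r (d - r) f (d - r) f))"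

lemma contraction_defect_nonneg: "0 \<le> contraction_defect n d f"
  by (simp add: contraction_defect_def sum_nonneg contraction_nsq_nonneg)

lemma influence_le_defect:
  assumes "d \<ge> 2" "mirror_symmetric n d f"
  shows "(\<Sum>p\<in>{p\<in>multi_indices n d. hd p = b}. (f p)\<^sup>2) \<le> contraction_defect n d f"
proof -
  have d: "Suc (d - 1) = d" "d - (d - 1) = 1" using assms(1) by auto
  have "(\<Sum>p\<in>{p\<in>multi_indices n d. hd p = b}. (f p)\<^sup>2) \<le> sqrt (contraction_nsq n (d - 1) 1 f 1 f)"
    using influence_le[of n "d - 1" f b] assms(2) unfolding d by simp
  also have "\<dots> = sqrt (contraction_nsq n (d - 1) (d - (d - 1)) f (d - (d - 1)) f)" by (simp only: d)
  also have "\<dots> \<le> contraction_defect n d f"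
    unfolding contraction_defect_def
    by (rule member_le_sum) (use assms(1) in \<open>auto simp: contraction_nsq_nonneg\<close>)
  finally show ?thesis .
qed

text \<open>The creation part is the unmerged part of \<open>r = 0\<close>: if the heads of
  \<open>p\<close> and \<open>q\<close> agree, \<open>rev p @ q\<close> has equal neighbours and is
  cut. In this form it can be subtracted coefficientwise.\<close>

lemma hsum_tensor_as_nord_sum:
  assumes "d \<ge> 1" "d \<le> m" and f: "mirror_symmetric n d f" "adjacent_free n d f"
  shows "hsum n (d + m) (adjacent_cut (tensor d f G)) =
    nord_sum n d m (\<lambda>r p q. if r = 0 \<and> \<not> merges p q then f p * adjacent_cut G q else 0)"
proof -
  let ?I = "multi_indices n"
  let ?k = "\<lambda>(r::nat) p q. if r = 0 \<and> \<not> merges p q then f p * adjacent_cut G q else 0"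
  let ?y = "\<lambda>p. prod_list (map Y p)"
  have "hsum n (d + m) (adjacent_cut (tensor d f G)) =
     (\<Sum>p\<in>?I d. \<Sum>q\<in>?I m. smul (complex_of_real (adjacent_cut (tensor d f G) (p @ q))) (?y (p @ q)))"
    unfolding homogeneous_sum_def by (rule sum_multi_indices_append)
  also have "\<dots> = (\<Sum>p\<in>?I d. \<Sum>q\<in>?I m. smul (complex_of_real (adjacent_cut (tensor d f G) (rev p @ q))) (?y (rev p @ q)))"
    by (rule sum_multi_indices_rev[symmetric])
  also have "\<dots> = (\<Sum>p\<in>?I (d - 0). \<Sum>q\<in>?I (m - 0). smul (complex_of_real (?k 0 p q)) (word (nord p q)))"
    unfolding diff_zero
  proof (intro sum.cong refl)
    fix p q assume p: "p \<in> ?I d" and q: "q \<in> ?I m"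
    have fp: "f (rev p) = f p" "\<not> distinct_adj p \<Longrightarrow> f p = 0"
      using f p by (auto simp: mirror_symmetric_def adjacent_free_def)
    have k: "adjacent_cut (tensor d f G) (rev p @ q) = ?k 0 p q"
      using fp multi_indices_length[OF p]
      by (auto simp: adjacent_cut_def tensor_def distinct_adj_rev_append merges_def)
    show "smul (complex_of_real (adjacent_cut (tensor d f G) (rev p @ q))) (?y (rev p @ q)) =
          smul (complex_of_real (?k 0 p q)) (word (nord p q))"
    proof (cases "merges p q")
      case False
      then have "word (nord p q) = ?y (rev p @ q)" by (simp add: nord_def word_False del: map_append)
      then show ?thesis using k False by simp
    qed (use k in simp)
  qed
  also have "\<dots> = nord_sum n d m ?k"
    unfolding nord_sum_def by (subst sum.atMost_shift) simp
  finally show ?thesis .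
qed

text \<open>The annihilation part sits at \<open>r = d\<close>, where \<open>p\<close> is
  empty.\<close>

lemma hsum_as_nord_sum:
  "smul (complex_of_real c) (hsum n (m - d) G) = nord_sum n d m (\<lambda>r p q. if r = d then c * G q else 0)"
proof -
  have "nord_sum n d m (\<lambda>r p q. if r = d then c * G q else 0) =
    (\<Sum>r\<in>{d}. \<Sum>p\<in>multi_indices n (d - r). \<Sum>q\<in>multi_indices n (m - r).
      smul (complex_of_real (c * G q)) (word (nord p q)))"
    unfolding nord_sum_def by (rule sum.mono_neutral_cong_right) auto
  then show ?thesis
    by (simp add: homogeneous_sum_def scale_sum_right nord_Nil word_False)
qed

text \<open>Without the cut, contracting \<open>f\<close> with \<open>g\<close> would leave the
  inner product times \<open>F q\<close>. The cut removes those \<open>p\<close> whose last index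
  equals the head of \<open>q\<close>; by Cauchy--Schwarz this loss is at most an influence of
  \<open>f\<close> times the norm of \<open>g\<close>.\<close>

lemma full_contraction_bound:
  assumes "d \<ge> 2" and f: "mirror_symmetric n d f" and g: "adjacent_free n d g"
    and q: "q \<in> multi_indices n l" "distinct_adj q"
  shows "(contraction n d f (adjacent_cut (tensor d g F)) [] q - c * F q)\<^sup>2 \<le>
    2 * (contraction_defect n d f * kernel_nsq n d g + ((\<Sum>p\<in>multi_indices n d. f p * g p) - c)\<^sup>2) * (F q)\<^sup>2"
proof -
  let ?I = "multi_indices n d"
  \<comment> \<open>For empty \<open>q\<close> there is no seam, and \<open>?J\<close> is
    empty.\<close>
  let ?J = "{p\<in>?I. q \<noteq> [] \<and> last p = hd q}"
  define h where "h = (\<Sum>p\<in>?J. f p * g p)"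
  define s where "s = (\<Sum>p\<in>?I. f p * g p)"
  have "contraction n d f (adjacent_cut (tensor d g F)) [] q = (\<Sum>p\<in>?I. (f p * g p - (if p \<in> ?J then f p * g p else 0)) * F q)"
    unfolding contraction_def
  proof (rule sum.cong[OF refl])
    fix p assume p: "p \<in> ?I"
    have "p \<noteq> []" using p assms(1) by (auto simp: multi_indices_def)
    moreover have "\<not> distinct_adj p \<Longrightarrow> g p = 0" using g p by (auto simp: adjacent_free_def)
    ultimately show "f (p @ []) * adjacent_cut (tensor d g F) (p @ q) = (f p * g p - (if p \<in> ?J then f p * g p else 0)) * F q"
      using p q(2) multi_indices_length[OF p]
      by (auto simp: adjacent_cut_def tensor_def distinct_adj_append_iff)
  qed
  also have "\<dots> = (s - h) * F q"
    unfolding sum_distrib_right[symmetric] sum_subtractf s_def h_def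
    by (simp add: sum.If_cases Int_def conj_commute)
  finally have e: "contraction n d f (adjacent_cut (tensor d g F)) [] q - c * F q = (s - c - h) * F q"
    by (simp add: algebra_simps)
  have "h\<^sup>2 \<le> (\<Sum>p\<in>?J. (f p)\<^sup>2) * (\<Sum>p\<in>?J. (g p)\<^sup>2)"
    unfolding h_def by (rule Cauchy_Schwarz_ineq_sum)
  also have "\<dots> \<le> contraction_defect n d f * kernel_nsq n d g"
  proof (rule mult_mono)
    have "(\<Sum>p\<in>?J. (f p)\<^sup>2) \<le> (\<Sum>p\<in>{p\<in>?I. last p = hd q}. (f p)\<^sup>2)"
      by (rule sum_mono2) auto
    also have "\<dots> = (\<Sum>p\<in>{p\<in>?I. hd p = hd q}. (f p)\<^sup>2)"
    proof (rule sum.reindex_bij_witness[of _ rev rev])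
      fix p assume "p \<in> {p\<in>?I. last p = hd q}"
      then have "f (rev p) = f p" using f by (auto simp: mirror_symmetric_def)
      then show "(f (rev p))\<^sup>2 = (f p)\<^sup>2" by simp
    qed (use assms(1) in \<open>auto simp: rev_multi_indices hd_rev last_rev multi_indices_def\<close>)
    also have "\<dots> \<le> contraction_defect n d f" by (rule influence_le_defect[OF assms(1) f])
    finally show "(\<Sum>p\<in>?J. (f p)\<^sup>2) \<le> contraction_defect n d f" .
    show "(\<Sum>p\<in>?J. (g p)\<^sup>2) \<le> kernel_nsq n d g"
      unfolding kernel_nsq_def by (rule sum_mono2) auto
  qed (auto simp: sum_nonneg contraction_defect_nonneg)
  finally have h: "h\<^sup>2 \<le> contraction_defect n d f * kernel_nsq n d g" .
  have "(s - c - h)\<^sup>2 \<le> 2 * (h\<^sup>2 + (s - c)\<^sup>2)"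
    using zero_le_power2[of "s - c + h"] by (simp add: power2_eq_square algebra_simps)
  also have "\<dots> \<le> 2 * (contraction_defect n d f * kernel_nsq n d g + (s - c)\<^sup>2)"
    using h by simp
  finally show ?thesis unfolding e power_mult_distrib s_def by (rule mult_right_mono) simp
qed

text \<open>Multiplication by a homogeneous sum acts on tensor products of kernels like the sum of a free
  creation and a free annihilation operator, up to an error that only depends on the contractions
  of the kernel with itself and on its inner product with the first tensor factor.\<close>

lemma creation_annihilation_error:
  assumes "d \<ge> 2" and f: "mirror_symmetric n d f" "adjacent_free n d f" and g: "adjacent_free n d g"
  shows "nsq (hsum n d f * hsum n (d + l) (adjacent_cut (tensor d g F))
      - hsum n (d + (d + l)) (adjacent_cut (tensor d f (tensor d g F)))
      - smul (complex_of_real c) (hsum n l (adjacent_cut F)))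
    \<le> K * ((4 * contraction_defect n d f * kernel_nsq n d g
        + 2 * ((\<Sum>p\<in>multi_indices n d. f p * g p) - c)\<^sup>2) * kernel_nsq n l F)"
proof -
  let ?I = "multi_indices n"
  define \<eta> where "\<eta> = contraction_defect n d f"
  define m where "m = d + l"
  define G where "G = adjacent_cut (tensor d g F)"
  define s where "s = (\<Sum>p\<in>?I d. f p * g p)"
  have dm: "d \<le> m" "m - d = l" by (simp_all add: m_def)
  have G2: "kernel_nsq n m G \<le> kernel_nsq n d g * kernel_nsq n l F"
    unfolding G_def m_def kernel_nsq_tensor[symmetric] by (rule kernel_nsq_cut_le)
  \<comment> \<open>What is left in \<open>k\<close>: the merged pairs for \<open>r = 0\<close>, the
    whole contraction for \<open>0 < r < d\<close>, and the deviation from \<open>c\<close> for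
    \<open>r = d\<close>.\<close>
  define k where "k r p q = contraction n r f G p q - (if r = 0 \<and> \<not> merges p q then f p * G q else 0)
       - (if r = d then c * adjacent_cut F q else 0)" for r p q
  have "hsum n d f * hsum n m G - hsum n (d + m) (adjacent_cut (tensor d f (tensor d g F)))
      - smul (complex_of_real c) (hsum n (m - d) (adjacent_cut F)) = nord_sum n d m k"
    unfolding hsum_mult[OF dm(1) f(1)] hsum_as_nord_sum k_def G_def
    by (subst hsum_tensor_as_nord_sum) (use assms(1) dm f in \<open>simp_all add: nord_sum_diff adjacent_cut_def cong: if_cong\<close>)
  moreover have "nsq (nord_sum n d m k) \<le> K * (\<Sum>r\<le>d. \<Sum>p\<in>?I (d - r). \<Sum>q\<in>?I (m - r). (k r p q)\<^sup>2)"
  proof (rule nsq_nord_sum_le[OF dm(1)])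
    fix r p q assume r: "r \<le> d" and p: "p \<in> ?I (d - r)" and q: "q \<in> ?I (m - r)"
      and nd: "\<not> distinct_adj p \<or> \<not> distinct_adj q"
    have 1: "contraction n r f G p q = 0"
      by (rule contraction_adjacent_free[of n r "d - r" f "m - r"])
         (use f p q r dm nd adjacent_free_cut in \<open>auto simp: G_def\<close>)
    have 2: "f p * G q = 0" if "r = 0"
      using that p nd f(2) by (auto simp: adjacent_free_def G_def adjacent_cut_def)
    have 3: "adjacent_cut F q = 0" if "r = d"
      using that p nd by (auto simp: adjacent_cut_def)
    show "k r p q = 0" using 1 2 3 by (simp add: k_def)
  qed
  moreover have "(\<Sum>r\<le>d. \<Sum>p\<in>?I (d - r). \<Sum>q\<in>?I (m - r). (k r p q)\<^sup>2) \<le>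
    (4 * \<eta> * kernel_nsq n d g + 2 * (s - c)\<^sup>2) * kernel_nsq n l F"
  proof -
    let ?t = "\<lambda>r. \<Sum>p\<in>?I (d - r). \<Sum>q\<in>?I (m - r). (k r p q)\<^sup>2"
    \<comment> \<open>For a merged pair the head of \<open>p\<close> is that of \<open>q\<close>, so
      the sum over \<open>p\<close> is an influence of \<open>f\<close>.\<close>
    have "?t 0 \<le> \<eta> * kernel_nsq n m G"
    proof -
      have "?t 0 = (\<Sum>q\<in>?I m. \<Sum>p\<in>?I d. (k 0 p q)\<^sup>2)"
        unfolding diff_zero by (rule sum.swap)
      also have "\<dots> \<le> (\<Sum>q\<in>?I m. \<eta> * (G q)\<^sup>2)"
      proof (rule sum_mono)
        fix q
        have "(\<Sum>p\<in>?I d. (k 0 p q)\<^sup>2) \<le> (\<Sum>p\<in>?I d. if hd p = hd q then (f p)\<^sup>2 * (G q)\<^sup>2 else 0)"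
          by (rule sum_mono)
            (use assms(1) in \<open>auto simp: k_def contraction_def merges_def power_mult_distrib\<close>)
        also have "\<dots> = (\<Sum>p\<in>{p\<in>?I d. hd p = hd q}. (f p)\<^sup>2 * (G q)\<^sup>2)"
          by (rule sum.inter_filter[symmetric]) simp
        also have "\<dots> = (\<Sum>p\<in>{p\<in>?I d. hd p = hd q}. (f p)\<^sup>2) * (G q)\<^sup>2"
          by (rule sum_distrib_right[symmetric])
        also have "\<dots> \<le> \<eta> * (G q)\<^sup>2"
          unfolding \<eta>_def by (rule mult_right_mono[OF influence_le_defect[OF assms(1) f(1)]]) simp
        finally show "(\<Sum>p\<in>?I d. (k 0 p q)\<^sup>2) \<le> \<eta> * (G q)\<^sup>2" .
      qed
      finally show ?thesis by (simp add: kernel_nsq_def sum_distrib_left)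
    qed
    moreover have "(\<Sum>r\<in>{1..<d}. ?t r) \<le> \<eta> * kernel_nsq n m G"
    proof -
      have "(\<Sum>r\<in>{1..<d}. ?t r) \<le> (\<Sum>r\<in>{1..<d}. sqrt (contraction_nsq n (d - r) r f r f) * kernel_nsq n m G)"
      proof (rule sum_mono)
        fix r assume r: "r \<in> {1..<d}"
        have "?t r = contraction_nsq n r (d - r) f (m - r) G"
          unfolding contraction_nsq_def k_def using r by simp
        also have "\<dots> \<le> sqrt (contraction_nsq n (d - r) r f r f) * kernel_nsq n (r + (m - r)) G"
          by (rule contraction_nsq_le) (use f r in simp)
        also have "r + (m - r) = m" using r dm by simp
        finally show "?t r \<le> sqrt (contraction_nsq n (d - r) r f r f) * kernel_nsq n m G" .
      qed
      also have "\<dots> = (\<Sum>r\<in>{1..<d}. sqrt (contraction_nsq n r (d - r) f (d - r) f)) * kernel_nsq n m G"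
        unfolding sum_distrib_right
        by (rule sum.reindex_bij_witness[of _ "\<lambda>r. d - r" "\<lambda>r. d - r"]) auto
      finally show ?thesis by (simp add: \<eta>_def contraction_defect_def)
    qed
    moreover have "?t d \<le> 2 * (\<eta> * kernel_nsq n d g + (s - c)\<^sup>2) * kernel_nsq n l F"
    proof -
      have "?t d = (\<Sum>q\<in>?I l. (k d [] q)\<^sup>2)" by (simp add: dm)
      also have "\<dots> \<le> (\<Sum>q\<in>?I l. 2 * (\<eta> * kernel_nsq n d g + (s - c)\<^sup>2) * (F q)\<^sup>2)"
      proof (rule sum_mono)
        fix q assume q: "q \<in> ?I l"
        show "(k d [] q)\<^sup>2 \<le> 2 * (\<eta> * kernel_nsq n d g + (s - c)\<^sup>2) * (F q)\<^sup>2"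
        proof (cases "distinct_adj q")
          case True
          then have "k d [] q = contraction n d f G [] q - c * F q"
            using assms(1) by (simp add: k_def adjacent_cut_def)
          then show ?thesis
            using full_contraction_bound[OF assms(1) f(1) g q True, of F c]
            by (simp add: G_def \<eta>_def s_def)
        next
          case False
          have "contraction n d f G [] q = 0"
            by (rule contraction_adjacent_free[of n d 0 f l])
               (use f q False adjacent_free_cut in \<open>auto simp: G_def\<close>)
          then have "k d [] q = 0"
            using False assms(1) by (simp add: k_def adjacent_cut_def)
          then show ?thesis
            by (simp add: \<eta>_def contraction_defect_nonneg kernel_nsq_nonneg)
        qed
      qed
      finally show ?thesis by (simp add: kernel_nsq_def sum_distrib_left)
    qed
    moreover have "\<eta> * kernel_nsq n m G \<le> \<eta> * (kernel_nsq n d g * kernel_nsq n l F)"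
      by (rule mult_left_mono[OF G2]) (simp add: \<eta>_def contraction_defect_nonneg)
    moreover have "(\<Sum>r\<le>d. ?t r) = ?t 0 + (?t d + (\<Sum>r\<in>{1..<d}. ?t r))"
    proof -
      have "{..d} = insert 0 (insert d {1..<d})" using assms(1) by auto
      then show ?thesis using assms(1) by simp
    qed
    \<comment> \<open>Of the constant 4, one comes from \<open>r = 0\<close>, one from the middle
      range and two from \<open>r = d\<close>.\<close>
    ultimately have "(\<Sum>r\<le>d. ?t r) \<le> 2 * (\<eta> * (kernel_nsq n d g * kernel_nsq n l F))
        + 2 * (\<eta> * kernel_nsq n d g + (s - c)\<^sup>2) * kernel_nsq n l F" by linarith
    also have "\<dots> = (4 * \<eta> * kernel_nsq n d g + 2 * (s - c)\<^sup>2) * kernel_nsq n l F"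
      by (simp add: algebra_simps)
    finally show ?thesis .
  qed
  then have "K * (\<Sum>r\<le>d. \<Sum>p\<in>?I (d - r). \<Sum>q\<in>?I (m - r). (k r p q)\<^sup>2) \<le>
    K * ((4 * \<eta> * kernel_nsq n d g + 2 * (s - c)\<^sup>2) * kernel_nsq n l F)"
    using K_ge by (intro mult_left_mono) auto
  ultimately show ?thesis unfolding dm(2) by (simp add: m_def G_def \<eta>_def s_def)
qed

end

section \<open>Joint moments\<close>

fun tensors :: "nat \<Rightarrow> (nat list \<Rightarrow> real) list \<Rightarrow> nat list \<Rightarrow> real" where
  "tensors d [] = (\<lambda>_. 1)"
| "tensors d (f # fs) = tensor d f (tensors d fs)"

lemma kernel_nsq_tensors:
  "kernel_nsq n (d * length fs) (tensors d fs) = (\<Prod>f\<leftarrow>fs. kernel_nsq n d f)"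
proof (induction fs)
  case Nil
  show ?case by (simp add: kernel_nsq_def)
next
  case (Cons f fs)
  then show ?case using kernel_nsq_tensor[of n d "d * length fs" f] by simp
qed

context free_family
begin

text \<open>The counterpart in the algebra of the simple tensor of the kernels \<open>fs\<close> in
  the Fock space; the vacuum corresponds to \<open>1\<close>.\<close>

definition wick :: "nat \<Rightarrow> nat \<Rightarrow> (nat list \<Rightarrow> real) list \<Rightarrow> 'a" where
  "wick n d fs = hsum n (d * length fs) (adjacent_cut (tensors d fs))"

lemma wick_Nil [simp]: "wick n d [] = 1"
  by (simp add: wick_def homogeneous_sum_def adjacent_cut_def)

lemma wick_single:
  assumes "adjacent_free n d f"
  shows "wick n d [f] = hsum n d f"
  unfolding wick_def homogeneous_sum_def
proof (rule sum.cong)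
  fix q assume "q \<in> multi_indices n d"
  then have "adjacent_cut (tensors d [f]) q = f q"
    using assms by (auto simp: adjacent_cut_def tensor_def adjacent_free_def multi_indices_length)
  then show "smul (complex_of_real (adjacent_cut (tensors d [f]) q)) (prod_list (map Y q)) =
      smul (complex_of_real (f q)) (prod_list (map Y q))" by simp
qed simp

lemma phi_wick:
  assumes "d \<ge> 1" "fs \<noteq> []"
  shows "phi (wick n d fs) = 0"
  unfolding wick_def homogeneous_sum_def phi_sum phi_smul
proof (rule sum.neutral, rule ballI)
  fix q assume q: "q \<in> multi_indices n (d * length fs)"
  then have "q \<noteq> []" using assms by (auto simp: multi_indices_def)
  then have "distinct_adj q \<Longrightarrow> phi (word (nord [] q)) = 0"
    using phi_nord[of "[]" n 0 q] q by simp
  then show "complex_of_real (adjacent_cut (tensors d fs) q) * phi (prod_list (map Y q)) = 0"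
    by (simp add: adjacent_cut_def nord_Nil word_False)
qed

lemma wick_recursion_error:
  assumes "d \<ge> 2" "mirror_symmetric n d f" "adjacent_free n d f" "adjacent_free n d g"
  shows "nsq (hsum n d f * wick n d (g # fs) - wick n d (f # g # fs) - smul (complex_of_real c) (wick n d fs))
    \<le> K * ((4 * contraction_defect n d f * kernel_nsq n d g
        + 2 * ((\<Sum>p\<in>multi_indices n d. f p * g p) - c)\<^sup>2) * (\<Prod>h\<leftarrow>fs. kernel_nsq n d h))"
  using creation_annihilation_error[OF assms, of "d * length fs" "tensors d fs" c]
  by (simp add: wick_def kernel_nsq_tensors)

text \<open>The norm is the moment of the palindrome \<open>js @ rev js\<close>, whose even length
  admits the chessboard estimate. The coordinate found there depends on \<open>X\<close>, later on
  \<open>n\<close>; summing over all coordinates removes this dependence.\<close>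

lemma nsq_star_product_le:
  fixes X :: "'m::finite \<Rightarrow> 'a"
  assumes "\<And>j. star (X j) = X j" "js \<noteq> []"
  shows "nsq (star (prod_list (map X js))) \<le> (\<Sum>j\<in>UNIV. cmod (phi (X j ^ (2 * length js))))"
proof -
  have st: "star (prod_list (map X js)) = prod_list (map X (rev js))"
    using assms(1) by (simp add: star_prod_list rev_map comp_def)
  have "length js \<ge> 1" using assms(2) by (cases js) auto
  then obtain j where j: "\<And>ks. length ks = 2 * length js \<Longrightarrow>
      cmod (phi (prod_list (map X ks))) \<le> cmod (phi (X j ^ (2 * length js)))"
    using chessboard_estimate[of X "length js", OF assms(1)] by blast
  have "nsq (star (prod_list (map X js))) = Re (phi (prod_list (map X (js @ rev js))))"
    by (subst nsq_star) (simp add: st)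
  also have "\<dots> \<le> cmod (phi (prod_list (map X (js @ rev js))))" by (rule complex_Re_le_cmod)
  also have "\<dots> \<le> cmod (phi (X j ^ (2 * length js)))" by (rule j) simp
  also have "\<dots> \<le> (\<Sum>j\<in>UNIV. cmod (phi (X j ^ (2 * length js))))"
    by (rule member_le_sum) auto
  finally show ?thesis .
qed

text \<open>The stack must be arbitrary for the induction: the rightmost factor acts on the Wick
  product and lengthens or shortens it.\<close>

lemma joint_moments_tendsto:
  fixes f :: "nat \<Rightarrow> 'm::finite \<Rightarrow> nat list \<Rightarrow> real" and c :: "'m \<Rightarrow> 'm \<Rightarrow> real"
  assumes d: "d \<ge> 2"
    and sym: "\<And>n j. mirror_symmetric n d (f n j)"
    and adj: "\<And>n j. adjacent_free n d (f n j)"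
    and cov: "\<And>i j. (\<lambda>n. \<Sum>p\<in>multi_indices n d. f n i p * f n j p) \<longlonglongrightarrow> c i j"
    and fourth: "\<And>j. (\<lambda>n. Re (phi (hsum n d (f n j) ^ 4))) \<longlonglongrightarrow> 2 * (c j j)\<^sup>2"
    and bdd: "\<And>j k. k \<ge> 1 \<Longrightarrow> Bseq (\<lambda>n. phi (hsum n d (f n j) ^ k))"
  shows "(\<lambda>n. phi (prod_list (map (\<lambda>j. hsum n d (f n j)) js) * wick n d (map (f n) st)))
     \<longlonglongrightarrow> complex_of_real (fock_moment c (rev js) st)"
proof -
  define X where "X n j = hsum n d (f n j)" for n j
  have X_star: "star (X n j) = X n j" for n j unfolding X_def by (rule star_hsum[OF sym])
  have kn: "(\<lambda>n. kernel_nsq n d (f n j)) \<longlonglongrightarrow> c j j" for j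
    using cov[of j j] by (simp add: kernel_nsq_def power2_eq_square)
  have "(\<lambda>n. contraction_nsq n r (d - r) (f n j) (d - r) (f n j)) \<longlonglongrightarrow> 0" if r: "r \<in> {1..<d}" for r j
  proof (rule tendsto_sandwich[where f = "\<lambda>_. 0"])
    \<comment> \<open>The slack in \<open>fourth_moment_ge\<close>; both of its terms tend to
      \<open>2 * (c j j)\<^sup>2\<close>.\<close>
    let ?u = "\<lambda>n. Re (phi (hsum n d (f n j) ^ 4)) - 2 * (kernel_nsq n d (f n j))\<^sup>2"
    have "?u \<longlonglongrightarrow> 2 * (c j j)\<^sup>2 - 2 * (c j j)\<^sup>2" by (intro tendsto_intros fourth kn)
    then show "?u \<longlonglongrightarrow> 0" by simp
    show "\<forall>\<^sub>F n in sequentially. contraction_nsq n r (d - r) (f n j) (d - r) (f n j) \<le> ?u n"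
    proof (intro always_eventually allI)
      fix n
      have "contraction_nsq n r (d - r) (f n j) (d - r) (f n j) \<le>
          (\<Sum>r\<in>{1..<d}. contraction_nsq n r (d - r) (f n j) (d - r) (f n j))"
        using r by (intro member_le_sum) (simp_all add: contraction_nsq_nonneg)
      then show "contraction_nsq n r (d - r) (f n j) (d - r) (f n j) \<le> ?u n"
        using fourth_moment_ge[of d n "f n j"] d sym adj by fastforce
    qed
  qed (simp_all add: contraction_nsq_nonneg)
  then have defect: "(\<lambda>n. contraction_defect n d (f n j)) \<longlonglongrightarrow> 0" for j
    unfolding contraction_defect_def by (intro tendsto_null_sum) (use tendsto_real_sqrt in fastforce)
  have prods: "(\<lambda>n. \<Prod>h\<leftarrow>map (f n) st. kernel_nsq n d h) \<longlonglongrightarrow> (\<Prod>i\<leftarrow>st. c i i)" for st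
    by (induction st) (auto intro!: tendsto_intros kn)
  define err where "err n j i st = X n j * wick n d (map (f n) (i # st)) - wick n d (map (f n) (j # i # st))
      - smul (complex_of_real (c j i)) (wick n d (map (f n) st))" for n j i st
  have err: "(\<lambda>n. nsq (err n j i st)) \<longlonglongrightarrow> 0" for j i st
  proof (rule tendsto_sandwich[where f = "\<lambda>_. 0"])
    let ?u = "\<lambda>n. K * ((4 * contraction_defect n d (f n j) * kernel_nsq n d (f n i)
        + 2 * ((\<Sum>p\<in>multi_indices n d. f n j p * f n i p) - c j i)\<^sup>2) * (\<Prod>h\<leftarrow>map (f n) st. kernel_nsq n d h))"
    have "?u \<longlonglongrightarrow> K * ((4 * 0 * c i i + 2 * (c j i - c j i)\<^sup>2) * (\<Prod>i\<leftarrow>st. c i i))"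
      by (intro tendsto_intros defect kn cov prods)
    then show "?u \<longlonglongrightarrow> 0" by simp
    show "\<forall>\<^sub>F n in sequentially. nsq (err n j i st) \<le> ?u n"
      unfolding err_def X_def list.map by (intro always_eventually allI wick_recursion_error[OF d sym adj adj])
  qed (simp_all add: nsq_nonneg)
  define P where "P n js = prod_list (map (X n) js)" for n js
  have bound: "\<exists>B. \<forall>n. nsq (star (P n js)) \<le> B" for js
  proof (cases "js = []")
    case True
    then show ?thesis by (auto simp: P_def)
  next
    case False
    then have "2 * length js \<ge> 1" by (cases js) auto
    then have "\<forall>j. \<exists>B. \<forall>n. cmod (phi (X n j ^ (2 * length js))) \<le> B"
      using bdd unfolding X_def Bseq_def by blast
    then obtain B where B: "\<And>j n. cmod (phi (X n j ^ (2 * length js))) \<le> B j" by metis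
    have "nsq (star (P n js)) \<le> (\<Sum>j\<in>UNIV. B j)" for n
      unfolding P_def by (rule order_trans[OF nsq_star_product_le[OF X_star False]]) (rule sum_mono, rule B)
    then show ?thesis by blast
  qed
  have small: "(\<lambda>n. phi (P n js * err n j i st)) \<longlonglongrightarrow> 0" for js j i st
  proof -
    \<comment> \<open>\<open>B\<close> does not depend on \<open>n\<close>, so Cauchy--Schwarz
      passes the smallness of \<open>err\<close> on to the product.\<close>
    obtain B where B: "\<And>n. nsq (star (P n js)) \<le> B" using bound by blast
    have "(\<lambda>n. sqrt (B * nsq (err n j i st))) \<longlonglongrightarrow> sqrt (B * 0)"
      by (intro tendsto_intros err)
    then have 0: "(\<lambda>n. sqrt (B * nsq (err n j i st))) \<longlonglongrightarrow> 0" by simp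
    have "cmod (phi (P n js * err n j i st)) \<le> sqrt (B * nsq (err n j i st))" for n
    proof (rule real_le_rsqrt)
      have "(cmod (phi (P n js * err n j i st)))\<^sup>2 \<le> nsq (star (P n js)) * nsq (err n j i st)"
        using phi_cauchy_schwarz[of "star (P n js)" "err n j i st"] by (simp add: star_star)
      also have "\<dots> \<le> B * nsq (err n j i st)"
        by (rule mult_right_mono[OF B nsq_nonneg])
      finally show "(cmod (phi (P n js * err n j i st)))\<^sup>2 \<le> B * nsq (err n j i st)" .
    qed
    then show ?thesis by (intro Lim_null_comparison[OF _ 0] always_eventually allI)
  qed
  have "(\<lambda>n. phi (P n js * wick n d (map (f n) st))) \<longlonglongrightarrow> complex_of_real (fock_moment c (rev js) st)"
  proof (induction js arbitrary: st rule: rev_induct)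
    case Nil
    have "phi (wick n d (map (f n) st)) = complex_of_real (fock_moment c [] st)" for n
      using d by (cases "st = []") (simp_all add: phi_unital phi_wick)
    then show ?case by (simp add: P_def)
  next
    case (snoc j js)
    show ?case
    proof (cases st)
      \<comment> \<open>On the vacuum, multiplication is pure creation, without error.\<close>
      case Nil
      have "P n (js @ [j]) * wick n d (map (f n) st) = P n js * wick n d (map (f n) [j])" for n
        by (simp add: P_def Nil wick_single[OF adj] X_def)
      then show ?thesis using snoc.IH[of "[j]"] by (simp add: Nil)
    next
      case (Cons i st')
      have "P n (js @ [j]) * wick n d (map (f n) st) = P n js * wick n d (map (f n) (j # st)) +
         smul (complex_of_real (c j i)) (P n js * wick n d (map (f n) st')) + P n js * err n j i st'" for n
      proof -
        have "X n j * wick n d (map (f n) st) = wick n d (map (f n) (j # st)) +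
            smul (complex_of_real (c j i)) (wick n d (map (f n) st')) + err n j i st'"
          by (simp add: err_def Cons)
        then show ?thesis
          by (simp add: P_def mult.assoc distrib_left smul_mult_right)
      qed
      then have "phi (P n (js @ [j]) * wick n d (map (f n) st)) = phi (P n js * wick n d (map (f n) (j # st))) +
         complex_of_real (c j i) * phi (P n js * wick n d (map (f n) st')) + phi (P n js * err n j i st')" for n
        by (simp add: phi_add phi_smul)
      moreover have "(\<lambda>n. phi (P n js * wick n d (map (f n) (j # st))) +
         complex_of_real (c j i) * phi (P n js * wick n d (map (f n) st')) + phi (P n js * err n j i st'))
        \<longlonglongrightarrow> complex_of_real (fock_moment c (rev js) (j # st)) +
           complex_of_real (c j i) * complex_of_real (fock_moment c (rev js) st') + 0"
        by (intro tendsto_intros snoc.IH small)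
      ultimately show ?thesis by (simp add: Cons)
    qed
  qed
  moreover have "X n = (\<lambda>j. hsum n d (f n j))" for n by (rule ext) (simp add: X_def)
  ultimately show ?thesis by (simp add: P_def)
qed

end

section \<open>From the hypotheses of the theorem to the joint moments\<close>

lemma semicircular_system_moment:
  assumes "semicircular_system star psi C s" "js \<noteq> []"
  shows "psi (prod_list (map s js)) = complex_of_real (fock_moment (\<lambda>i j. C $ i $ j) (rev js) [])"
proof -
  have "fock_moment (\<lambda>i j. C $ i $ j) (rev (drop 0 (take (length js) js))) [] =
      nc_pairing_sum (\<lambda>x y. C $ (js ! x) $ (js ! y)) {0..<length js}"
    by (rule fock_moment_eq_nc_pairing_sum) simp_all
  then show ?thesis
    using assms by (simp add: semicircular_system_def nc_pairing_sum_def atLeast0LessThan)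
qed

lemma symmetric_kernel_imp_mirror_symmetric:
  assumes "symmetric_kernel n d f"
  shows "mirror_symmetric n d f"
  unfolding mirror_symmetric_def
proof
  fix p assume p: "p \<in> multi_indices n d"
  define \<sigma> where "\<sigma> i = (if i < d then d - 1 - i else i)" for i
  have inv: "\<sigma> (\<sigma> i) = i" for i by (auto simp: \<sigma>_def)
  have \<sigma>: "\<sigma> permutes {..<d}"
    unfolding permutes_def
  proof (intro conjI allI impI)
    show "\<exists>!x. \<sigma> x = y" for y by (rule ex1I[of _ "\<sigma> y"]) (auto simp: inv)
  qed (simp add: \<sigma>_def)
  have "permute_list \<sigma> p = rev p"
    using multi_indices_length[OF p]
    by (intro nth_equalityI) (auto simp: permute_list_def rev_nth \<sigma>_def)
  then show "f (rev p) = f p"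
    using assms p \<sigma> unfolding symmetric_kernel_def by metis
qed

lemma vanishes_on_diagonals_imp_adjacent_free:
  assumes "vanishes_on_diagonals n d f"
  shows "adjacent_free n d f"
  unfolding adjacent_free_def
proof (intro ballI impI)
  fix p assume p: "p \<in> multi_indices n d" "\<not> distinct_adj p"
  then obtain j where "Suc j < d" "p ! j = p ! Suc j"
    using multi_indices_length[OF p(1)] by (auto simp: distinct_adj_conv_nth)
  then have "\<exists>j<d. \<exists>k<d. j \<noteq> k \<and> p ! j = p ! k"
    by (metis Suc_lessD n_not_Suc_n)
  then show "f p = 0" using assms p(1) unfolding vanishes_on_diagonals_def by blast
qed

theorem theorem3p5:
  fixes d :: nat
    and smul :: "complex \<Rightarrow> 'a::ring_1 \<Rightarrow> 'a" and star :: "'a \<Rightarrow> 'a" and phi :: "'a \<Rightarrow> complex"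
    and Y :: 'a and Ys :: "nat \<Rightarrow> 'a"
    and f :: "nat \<Rightarrow> 'm::finite \<Rightarrow> nat list \<Rightarrow> real"
    and C :: "real ^ 'm ^ 'm"
    and smul' :: "complex \<Rightarrow> 'b::ring_1 \<Rightarrow> 'b" and star' :: "'b \<Rightarrow> 'b" and psi :: "'b \<Rightarrow> complex"
    and s :: "'m \<Rightarrow> 'b"
  assumes "d \<ge> 2"
    and "nc_prob_space smul star phi"
    and "self_adjoint star Y"
    and "phi Y = 0"
    and "phi (Y ^ 2) = 1"
    and "phi (Y ^ 4) - 2 \<in> \<real>\<^sub>\<ge>\<^sub>0"
    and "\<And>i. i \<ge> 1 \<Longrightarrow> copy_of star phi Y (Ys i)"
    and "freely_independent smul star phi {1..} Ys"
    and "\<And>n j. n \<ge> 1 \<Longrightarrow> symmetric_kernel n d (f n j)"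
    and "\<And>n j. n \<ge> 1 \<Longrightarrow> vanishes_on_diagonals n d (f n j)"
    and "symmetric_positive_definite C"
    and "\<And>i j. (\<lambda>n. phi (homogeneous_sum smul Ys n d (f n j) * homogeneous_sum smul Ys n d (f n i)))
           \<longlonglongrightarrow> complex_of_real (C $ i $ j)"
    and "nc_prob_space smul' star' psi"
    and "semicircular_system star' psi C s"
  shows "(\<forall>j. converges_in_law phi psi (\<lambda>n. homogeneous_sum smul Ys n d (f n j)) (s j)) \<longleftrightarrow>
         jointly_converges_in_law phi psi (\<lambda>n j. homogeneous_sum smul Ys n d (f n j)) s"
proof -
  \<comment> \<open>The squared norm of $Y^2 - 1$; the cumulant condition becomes
    \<open>K \<ge> 1\<close>.\<close>
  define K where "K = Re (phi (Y ^ 4)) - 1"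
  have K: "phi (Y ^ 4) = complex_of_real (K + 1)" "K \<ge> 1"
    using assms(6) by (auto simp: K_def complex_nonneg_Reals_iff complex_eq_iff)
  have mom: "phi (Ys i ^ k) = phi (Y ^ k)" if "i \<ge> 1" "k \<ge> 1" for i k
    using assms(7)[OF that(1)] that(2) by (simp add: copy_of_def)
  have sa: "star (Ys i) = Ys i" if "i \<ge> 1" for i
    using assms(7)[OF that] by (simp add: copy_of_def self_adjoint_def)
  interpret nc_prob_space smul star phi by (rule assms(2))
  interpret free_family smul star phi Ys K
  proof (unfold_locales)
    fix i :: nat assume i: "i \<ge> 1"
    show "phi (Ys i) = 0" using mom[OF i, of 1] assms(4) by simp
    show "phi (Ys i * Ys i) = 1" using mom[OF i, of 2] assms(5) by (simp add: power2_eq_square)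
    show "phi (Ys i * Ys i * (Ys i * Ys i)) = complex_of_real (K + 1)"
      using mom[OF i, of 4] K(1) by (simp add: power4_eq_xxxx mult.assoc)
  qed (use assms(8) sa K(2) in auto)
  \<comment> \<open>The kernels are constrained for \<open>n \<ge> 1\<close> only; for
    \<open>n = 0\<close> there are no multi-indices, so both properties hold trivially.\<close>
  have empty: "multi_indices 0 d = {}" using assms(1) by (auto simp: multi_indices_def)
  have sym: "mirror_symmetric n d (f n j)" for n j
    using symmetric_kernel_imp_mirror_symmetric[OF assms(9)] empty
    by (cases "n = 0") (auto simp: mirror_symmetric_def)
  have adj: "adjacent_free n d (f n j)" for n j
    using vanishes_on_diagonals_imp_adjacent_free[OF assms(10)] empty
    by (cases "n = 0") (auto simp: adjacent_free_def)
  let ?X = "\<lambda>n j. hsum n d (f n j)" and ?c = "\<lambda>i j. C $ i $ j"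
  have Csym: "C $ i $ j = C $ j $ i" for i j
    using assms(11) unfolding symmetric_positive_definite_def by blast
  show ?thesis
  proof
    assume R: "jointly_converges_in_law phi psi ?X s"
    show "\<forall>j. converges_in_law phi psi (\<lambda>n. ?X n j) (s j)"
      unfolding converges_in_law_def
    proof (intro allI impI)
      fix j :: 'm and k :: nat assume "k \<ge> 1"
      then have "replicate k j \<noteq> []" by simp
      then have "(\<lambda>n. phi (prod_list (map (?X n) (replicate k j)))) \<longlonglongrightarrow> psi (prod_list (map s (replicate k j)))"
        using R unfolding jointly_converges_in_law_def by blast
      then show "(\<lambda>n. phi (?X n j ^ k)) \<longlonglongrightarrow> psi (s j ^ k)" by simp
    qed
  next
    assume L: "\<forall>j. converges_in_law phi psi (\<lambda>n. ?X n j) (s j)"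
    have conv: "(\<lambda>n. phi (?X n j ^ k)) \<longlonglongrightarrow> psi (s j ^ k)" if "k \<ge> 1" for j k
      using L that unfolding converges_in_law_def by blast
    \<comment> \<open>The hypothesis pairs the kernels in the order opposite to the indices of
      \<open>C\<close>; symmetry of \<open>C\<close> corrects this.\<close>
    have cov: "(\<lambda>n. \<Sum>p\<in>multi_indices n d. f n i p * f n j p) \<longlonglongrightarrow> ?c i j" for i j
      using tendsto_Re[OF assms(12)[of i j]] unfolding phi_hsum_mult[OF sym adj adj] Re_complex_of_real Csym[of j i] .
    have fourth: "(\<lambda>n. Re (phi (?X n j ^ 4))) \<longlonglongrightarrow> 2 * (?c j j)\<^sup>2" for j
    proof -
      \<comment> \<open>Four points have two non-crossing pairings.\<close>
      have "psi (s j ^ 4) = complex_of_real (2 * (?c j j)\<^sup>2)"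
        using semicircular_system_moment[OF assms(14), of "[j, j, j, j]"]
        by (simp add: power4_eq_xxxx mult.assoc power2_eq_square)
      then show ?thesis using tendsto_Re[OF conv[of 4 j]] by simp
    qed
    have bdd: "Bseq (\<lambda>n. phi (?X n j ^ k))" if "k \<ge> 1" for j k
      using conv[OF that] by (intro convergent_imp_Bseq convergentI)
    show "jointly_converges_in_law phi psi ?X s"
      unfolding jointly_converges_in_law_def
    proof (intro allI impI)
      fix js :: "'m list" assume "js \<noteq> []"
      then show "(\<lambda>n. phi (prod_list (map (?X n) js))) \<longlonglongrightarrow> psi (prod_list (map s js))"
        \<comment> \<open>The empty stack turns the Wick factor into \<open>1\<close>.\<close>
        using joint_moments_tendsto[where f = f and c = ?c, OF assms(1) sym adj cov fourth bdd, of js "[]"]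
          semicircular_system_moment[OF assms(14)] by simp
    qed
  qed
qed

end
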